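(* Let $X$ be a Banach space and let $J\in F(X)$ be lower semicontinuous. If $J$ is strongly adequate, then $J$ is essentially firmly subdifferentiable. Conversely, if $X$ is reflexive and $J$ is essentially firmly subdifferentiable, then $J$ is strongly adequate.
   Context: $X$ is a (real) Banach space with topological dual $X^*$ and bidual $X^{**}$; $\langle x,x^*\rangle:=x^*(x)$. $F(X)$ is the class of functions $J:X\to\mathbb{R}\cup\{+\infty\}$ with $\operatorname{dom}J:=\{x\in X: J(x)<\infty\}\neq\emptyset$. Lower semicontinuity is with respect to the norm topology. Conjugate: $J^*(x^* ):=\sup_{x\in X}(\langle x,x^*\rangle-J(x))$ for $x^*\in X^*$. Subdifferentials (for $J$ not necessarily convex): $\partial J(x):=\{x^*\in X^*: J(u)\ge J(x)+\langle u-x,x^*\rangle\ \forall u\in X\}$ if $J(x)\in\mathbb{R}$, and $\partial J(x):=\emptyset$ otherwise. Likewise $\partial J^*(x^* ):=\{x^{**}\in X^{**}: J^*(u^* )\ge J^*(x^* )+\langle u^*-x^*,x^{**}\rangle\ \forall u^*\in X^*\}$ if $J^*(x^* )\in\mathbb{R}$, and $\emptyset$ otherwise. The domain of a set-valued map is the set of points where its value is nonempty, e.g. $\operatorname{dom}\partial J^*=\{x^*\in X^*:\partial J^*(x^* )\ne\emptyset\}$. A function $I\in F(X)$ attains a strong minimum over $X$ if it has a minimum point $\bar x\in X$ and every minimizing sequence $(x_n)$ (that is, $I(x_n)\to\inf_X I$) converges in norm to $\bar x$. $J\in F(X)$ is strongly adequate if $\operatorname{dom}\partial J^*$ is a nonempty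 open subset of $X^*$ and $J-x^*$ attains a strong minimum over $X$ for every $x^*\in\operatorname{dom}\partial J^*$. $\Gamma_0$ is the set of lower semicontinuous convex functions $\psi:\mathbb{R}_+\to[0,\infty]$ such that $\psi(t)=0\iff t=0$. A convex function $H\in F(X)$ is firmly subdifferentiable at $x\in\operatorname{dom}\partial H$ if for every $x^*\in\partial H(x)$ there exists $\psi\in\Gamma_0$ such that $H(u)\ge H(x)+\langle u-x,x^*\rangle+\psi(\|u-x\|)$ for all $u\in X$. A function $H\in F(X)$ is essentially firmly subdifferentiable if it is convex and is firmly subdifferentiable at each point of $\operatorname{dom}\partial H$. *)

theory Defs
  imports "HOL-Analysis.Analysis"
begin

definition proper_fun :: "('a \<Rightarrow> ereal) \<Rightarrow> bool" where
  "proper_fun J \<longleftrightarrow> (\<forall>x. J x \<noteq> - \<infinity>) \<and> (\<exists>x. J x < \<infinity>)"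

(* The punctured filter "at x within S" suffices: the bound at x itself is trivial. *)
definition lsc_on :: "'a::topological_space set \<Rightarrow> ('a \<Rightarrow> ereal) \<Rightarrow> bool" where
  "lsc_on S f \<longleftrightarrow> (\<forall>x\<in>S. f x \<le> Liminf (at x within S) f)"

(* Intended for functions that never take the value minus infinity; the weights are
   strictly positive so that no product of 0 and infinity occurs. *)
definition ereal_convex_on :: "'a::real_vector set \<Rightarrow> ('a \<Rightarrow> ereal) \<Rightarrow> bool" where
  "ereal_convex_on S f \<longleftrightarrow> convex S \<and>
    (\<forall>x\<in>S. \<forall>y\<in>S. \<forall>u>0. \<forall>v>0. u + v = 1 \<longrightarrow>
      f (u *\<^sub>R x + v *\<^sub>R y) \<le> ereal u * f x + ereal v * f y)"

(* The topological dual of 'a is the type 'a \<Rightarrow>\<^sub>L real with the operator norm. *)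
definition conjugate :: "('a::real_normed_vector \<Rightarrow> ereal) \<Rightarrow> ('a \<Rightarrow>\<^sub>L real) \<Rightarrow> ereal" where
  "conjugate J f = (SUP x. ereal (blinfun_apply f x) - J x)"

(* Polymorphic: for a function on the dual, such as conjugate J, the values are
   subsets of the bidual. *)
definition subdifferential :: "('a::real_normed_vector \<Rightarrow> ereal) \<Rightarrow> 'a \<Rightarrow> ('a \<Rightarrow>\<^sub>L real) set" where
  "subdifferential J x =
    (if \<bar>J x\<bar> \<noteq> \<infinity> then {f. \<forall>u. J u \<ge> J x + ereal (blinfun_apply f (u - x))} else {})"

definition dom_subdifferential :: "('a::real_normed_vector \<Rightarrow> ereal) \<Rightarrow> 'a set" where
  "dom_subdifferential J = {x. subdifferential J x \<noteq> {}}"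

definition attains_strong_minimum :: "('a::real_normed_vector \<Rightarrow> ereal) \<Rightarrow> bool" where
  "attains_strong_minimum I \<longleftrightarrow> proper_fun I \<and>
    (\<exists>x0. (\<forall>u. I x0 \<le> I u) \<and>
      (\<forall>x :: nat \<Rightarrow> 'a. (\<lambda>n. I (x n)) \<longlonglongrightarrow> (INF u. I u) \<longrightarrow> x \<longlonglongrightarrow> x0))"

definition strongly_adequate :: "('a::real_normed_vector \<Rightarrow> ereal) \<Rightarrow> bool" where
  "strongly_adequate J \<longleftrightarrow> proper_fun J \<and>
    dom_subdifferential (conjugate J) \<noteq> {} \<and>
    open (dom_subdifferential (conjugate J)) \<and>
    (\<forall>f \<in> dom_subdifferential (conjugate J).
      attains_strong_minimum (\<lambda>x. J x - ereal (blinfun_apply f x)))"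

(* Functions on the half-line {0..}; values at negative reals are irrelevant. *)
definition Gamma0 :: "(real \<Rightarrow> ereal) set" where
  "Gamma0 = {\<psi>. (\<forall>t\<ge>0. \<psi> t \<ge> 0) \<and> lsc_on {0..} \<psi> \<and> ereal_convex_on {0..} \<psi> \<and>
    (\<forall>t\<ge>0. \<psi> t = 0 \<longleftrightarrow> t = 0)}"

definition firmly_subdifferentiable_at :: "('a::real_normed_vector \<Rightarrow> ereal) \<Rightarrow> 'a \<Rightarrow> bool" where
  "firmly_subdifferentiable_at H x \<longleftrightarrow> x \<in> dom_subdifferential H \<and>
    (\<forall>f \<in> subdifferential H x. \<exists>\<psi> \<in> Gamma0. \<forall>u.
      H u \<ge> H x + ereal (blinfun_apply f (u - x)) + \<psi> (norm (u - x)))"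

definition essentially_firmly_subdifferentiable :: "('a::real_normed_vector \<Rightarrow> ereal) \<Rightarrow> bool" where
  "essentially_firmly_subdifferentiable H \<longleftrightarrow> proper_fun H \<and> ereal_convex_on UNIV H \<and>
    (\<forall>x \<in> dom_subdifferential H. firmly_subdifferentiable_at H x)"

(* The canonical embedding of 'a into its bidual is onto. *)
definition reflexive_space :: "'a::real_normed_vector itself \<Rightarrow> bool" where
  "reflexive_space _ \<longleftrightarrow>
    (\<forall>F :: ('a \<Rightarrow>\<^sub>L real) \<Rightarrow>\<^sub>L real. \<exists>x :: 'a. \<forall>f. blinfun_apply F f = blinfun_apply f x)"

end

theory Submission
  imports Defs
begin

text \<open>
  Both properties in the theorem are about the pairs \<open>(x, f)\<close> with \<open>f \<in> \<partial>J(x)\<close>, and for such a pair they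
  say the same: the gap between \<open>J\<close> and its tangent affine function with slope \<open>f\<close> is bounded away from
  0 outside every ball around \<open>x\<close> (\<open>strong_subgradient\<close>). For arbitrary \<open>J\<close> this means that \<open>J - f\<close> has a
  strong minimum at \<open>x\<close> (\<open>strong_minimum_iff\<close>). For convex \<open>J\<close> the gap grows linearly outside
  each ball, and the supremum of the resulting hinge functions is a function in \<open>Gamma0\<close>
  (\<open>strong_subgradient_iff_Gamma0\<close>). What remains is to relate \<open>\<partial>J\<close> to \<open>\<partial>J\<^sup>*\<close>.

  Let \<open>J\<close> be strongly adequate. The point is that \<open>J\<close> is convex, that is, \<open>J = J\<^sup>*\<^sup>*\<close>. At a slope \<open>f\<close> for
  which \<open>J - f\<close> has a strong minimum point \<open>x\<close>, a subgradient of \<open>J\<^sup>*\<close> can only be \<open>x\<close>, since \<open>J\<^sup>*\<close> is finite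
  around \<open>f\<close> (\<open>subdifferential_conjugate_at_strong_subgradient\<close>); thus all subgradients of \<open>J\<^sup>*\<close> are
  points of the space, and there \<open>J\<close> and \<open>J\<^sup>*\<^sup>*\<close> agree. By the Bronsted-Rockafellar theorem, applied to \<open>J\<^sup>*\<close>
  on the dual space, such points approximate every point \<open>x0\<close> together with its value \<open>J\<^sup>*\<^sup>* x0\<close>, and lower
  semicontinuity of \<open>J\<close> gives \<open>J x0 \<le> J\<^sup>*\<^sup>* x0\<close> (\<open>dense_subgradients_biconjugate\<close>).

  Conversely, let \<open>J\<close> be convex and firmly subdifferentiable. By reflexivity a subgradient of \<open>J\<^sup>*\<close> at \<open>f\<close>
  is a point \<open>x\<close>, and the Fenchel-Moreau theorem (\<open>affine_minorant\<close>) gives \<open>f \<in> \<partial>J(x)\<close>, hence a strong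
  minimum of \<open>J - f\<close>. The domain of \<open>\<partial>J\<^sup>*\<close> is nonempty by the Bronsted-Rockafellar theorem. It is open
  because the linear growth of \<open>J - f\<close> bounds \<open>J\<^sup>*\<close> above on a ball around \<open>f\<close>, and a convex function that
  is bounded above on a neighbourhood of a point is subdifferentiable there.

  All subgradients are produced by one separation lemma (\<open>sandwich\<close>), which rests on the analytic
  Hahn-Banach theorem (\<open>Hahn_Banach_sublinear\<close>).
\<close>

section \<open>Linear functionals below sublinear ones\<close>

text \<open>
  Only inequalities are asked for: homogeneity on the positive reals follows by rescaling with the
  inverse factor, and the case \<open>c = 0\<close> forces the value 0 at the origin. One-sided conditions are
  what infima of families inherit directly.
\<close>
definition sublinear :: "('a::real_vector \<Rightarrow> real) \<Rightarrow> bool" where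
  "sublinear q \<longleftrightarrow> (\<forall>x y. q (x + y) \<le> q x + q y) \<and> (\<forall>c\<ge>0. \<forall>x. q (c *\<^sub>R x) \<le> c * q x)"

lemma sublinear_add: "sublinear q \<Longrightarrow> q (x + y) \<le> q x + q y"
  by (simp add: sublinear_def)

lemma sublinear_scale: "sublinear q \<Longrightarrow> 0 \<le> c \<Longrightarrow> q (c *\<^sub>R x) \<le> c * q x"
  by (simp add: sublinear_def)

lemma sublinear_zero:
  assumes "sublinear q" shows "q 0 = 0"
  using sublinear_scale[OF assms, of 0 0] sublinear_add[OF assms, of 0 0] by simp

lemma sublinear_neg:
  assumes "sublinear q" shows "- q (- x) \<le> q x"
  using sublinear_add[OF assms, of x "- x"] sublinear_zero[OF assms] by simp

lemma sublinear_scale_ge: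
  assumes q: "sublinear q" and c: "0 \<le> c" shows "c * q x \<le> q (c *\<^sub>R x)"
proof (cases "c = 0")
  case True then show ?thesis using sublinear_zero[OF q] by simp
next
  case False
  with c have "0 < c" by simp
  then have "q x \<le> inverse c * q (c *\<^sub>R x)"
    using sublinear_scale[OF q, of "inverse c" "c *\<^sub>R x"] by simp
  then show ?thesis using \<open>0 < c\<close> by (simp add: field_simps)
qed

text \<open>
  The two values in the bound \<open>INF q x + INF q y\<close> come from different members of the family;
  replacing both by the smaller member makes subadditivity of a single one applicable. This supplies
  lower bounds of chains for Zorn's lemma.
\<close>
lemma sublinear_INF:
  fixes C :: "('a::real_vector \<Rightarrow> real) set"
  assumes sub: "\<And>q. q \<in> C \<Longrightarrow> sublinear q" and ne: "C \<noteq> {}"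
    and dir: "\<And>q r. q \<in> C \<Longrightarrow> r \<in> C \<Longrightarrow> q \<le> r \<or> r \<le> q"
    and bdd: "\<And>x. bdd_below ((\<lambda>q. q x) ` C)"
  shows "sublinear (\<lambda>x. INF q\<in>C. q x)"
  unfolding sublinear_def
proof (intro conjI allI impI)
  fix x y
  have "(INF q\<in>C. q (x + y)) \<le> q x + r y" if qr: "q \<in> C" "r \<in> C" for q r
  proof -
    obtain s where s: "s \<in> C" "s \<le> q" "s \<le> r" using dir[OF qr] qr by auto
    have "(INF q\<in>C. q (x + y)) \<le> s (x + y)" by (rule cINF_lower[OF bdd s(1)])
    also have "\<dots> \<le> s x + s y" by (rule sublinear_add[OF sub[OF s(1)]])
    also have "\<dots> \<le> q x + r y" using s(2,3) by (simp add: le_fun_def add_mono)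
    finally show ?thesis .
  qed
  then have "(INF q\<in>C. q (x + y)) - q x \<le> (INF r\<in>C. r y)" if "q \<in> C" for q
    using that ne by (intro cINF_greatest) (force simp: algebra_simps)+
  then have "(INF q\<in>C. q (x + y)) - (INF r\<in>C. r y) \<le> (INF q\<in>C. q x)"
    using ne by (intro cINF_greatest) (auto simp: algebra_simps)
  then show "(INF q\<in>C. q (x + y)) \<le> (INF q\<in>C. q x) + (INF q\<in>C. q y)" by simp
next
  fix c :: real and x assume c: "0 \<le> c"
  have *: "(INF q\<in>C. q (c *\<^sub>R x)) \<le> c * q x" if "q \<in> C" for q
    using cINF_lower[OF bdd[of "c *\<^sub>R x"] that] sublinear_scale[OF sub[OF that] c, of x] by linarith
  show "(INF q\<in>C. q (c *\<^sub>R x)) \<le> c * (INF q\<in>C. q x)"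
  proof (cases "c = 0")
    case True with * ne show ?thesis by auto
  next
    case False
    with c have "0 < c" by simp
    have "(INF q\<in>C. q (c *\<^sub>R x)) / c \<le> (INF q\<in>C. q x)"
      using * ne \<open>0 < c\<close> by (intro cINF_greatest) (auto simp: field_simps)
    then show ?thesis using \<open>0 < c\<close> by (simp add: field_simps)
  qed
qed

text \<open>
  This infimum pushes \<open>m\<close> down to the value \<open>- m y\<close> at \<open>- y\<close>, the smallest one possible. If \<open>m\<close> is
  minimal among sublinear functionals, \<open>r = m\<close> must hold, and then \<open>t = 1\<close> yields
  \<open>m (x + y) \<ge> m x + m y\<close>.
\<close>
lemma sublinear_directional:
  fixes y :: "'a::real_vector"
  assumes m: "sublinear m"
    and r: "r = (\<lambda>x. INF t\<in>{0..}. m (x + t *\<^sub>R y) - t * m y)"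
  shows "sublinear r" and "\<And>x t. 0 \<le> t \<Longrightarrow> r x \<le> m (x + t *\<^sub>R y) - t * m y"
proof -
  \<comment> \<open>Bounds the infimum from below, so that it is a genuine infimum of reals.\<close>
  have "- m (- x) \<le> m (x + t *\<^sub>R y) - t * m y" if "0 \<le> t" for x t
    using sublinear_add[OF m, of "x + t *\<^sub>R y" "- x"] sublinear_scale_ge[OF m that, of y] by simp
  then have bdd: "bdd_below ((\<lambda>t. m (x + t *\<^sub>R y) - t * m y) ` {0..})" for x
    by (intro bdd_belowI2[where m="- m (- x)"]) auto
  show low: "r x \<le> m (x + t *\<^sub>R y) - t * m y" if "0 \<le> t" for x t
    unfolding r using that by (intro cINF_lower[OF bdd]) auto
  have great: "a \<le> r x" if "\<And>t. 0 \<le> t \<Longrightarrow> a \<le> m (x + t *\<^sub>R y) - t * m y" for a x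
    unfolding r using that by (intro cINF_greatest) auto
  show "sublinear r"
    unfolding sublinear_def
  proof (intro conjI allI impI)
    fix x z
    have "r (x + z) \<le> (m (x + s *\<^sub>R y) - s * m y) + (m (z + t *\<^sub>R y) - t * m y)"
      if "0 \<le> s" "0 \<le> t" for s t
    proof -
      have "r (x + z) \<le> m ((x + s *\<^sub>R y) + (z + t *\<^sub>R y)) - (s + t) * m y"
        using low[of "s + t" "x + z"] that by (simp add: algebra_simps)
      then show ?thesis
        using sublinear_add[OF m, of "x + s *\<^sub>R y" "z + t *\<^sub>R y"] by (simp add: algebra_simps)
    qed
    then have "r (x + z) - (m (x + s *\<^sub>R y) - s * m y) \<le> r z" if "0 \<le> s" for s
      using that by (intro great) (force simp: algebra_simps)
    then have "r (x + z) - r z \<le> r x"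
      by (intro great) (force simp: algebra_simps)
    then show "r (x + z) \<le> r x + r z" by simp
  next
    fix c :: real and x assume c: "0 \<le> c"
    have *: "r (c *\<^sub>R x) \<le> c * (m (x + t *\<^sub>R y) - t * m y)" if "0 \<le> t" for t
      using low[of "c * t" "c *\<^sub>R x"] sublinear_scale[OF m c, of "x + t *\<^sub>R y"] that c
      by (simp add: algebra_simps)
    show "r (c *\<^sub>R x) \<le> c * r x"
    proof (cases "c = 0")
      case True with *[of 0] show ?thesis by simp
    next
      case False
      with c have "0 < c" by simp
      have "r (c *\<^sub>R x) / c \<le> r x"
        using * \<open>0 < c\<close> by (intro great) (auto simp: pos_divide_le_eq mult.commute)
      then show ?thesis using \<open>0 < c\<close> by (simp add: field_simps)
    qed
  qed
qed

text \<open>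
  A minimal sublinear functional below \<open>p\<close> exists by Zorn's lemma, and minimality makes it additive,
  hence linear. Working with minimal functionals on the whole space avoids extending partial linear
  functionals from subspaces.
\<close>
theorem Hahn_Banach_sublinear:
  fixes p :: "'a::real_vector \<Rightarrow> real"
  assumes p: "sublinear p"
  obtains f where "linear f" and "\<And>x. f x \<le> p x"
proof -
  define A where "A = {q. sublinear q \<and> q \<le> p}"
  have po: "partial_order_on A (relation_of (\<lambda>q r. r \<le> q) A)"
    by (rule partial_order_on_relation_ofI) auto
  have ch: "\<exists>u\<in>A. \<forall>q\<in>C. u \<le> q" if "C \<in> Chains (relation_of (\<lambda>q r. r \<le> q) A)" for C
  proof (cases "C = {}")
    case True
    then show ?thesis using p by (auto simp: A_def)
  next
    case False
    have CA: "C \<subseteq> A" and tot: "\<And>q r. q \<in> C \<Longrightarrow> r \<in> C \<Longrightarrow> q \<le> r \<or> r \<le> q"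
      using that by (auto simp: Chains_def relation_of_def)
    have bdd: "bdd_below ((\<lambda>q. q x) ` C)" for x
    proof (rule bdd_belowI2)
      fix q assume "q \<in> C"
      then have "sublinear q" "q (- x) \<le> p (- x)" using CA by (auto simp: A_def le_fun_def)
      then show "- p (- x) \<le> q x" using sublinear_neg[of q x] by linarith
    qed
    define u where "u = (\<lambda>x. INF q\<in>C. q x)"
    have low: "u \<le> q" if "q \<in> C" for q
      unfolding u_def le_fun_def using cINF_lower[OF bdd that] by blast
    have "sublinear u"
      unfolding u_def
      using CA by (intro sublinear_INF[OF _ False tot bdd]) (auto simp: A_def)
    moreover have "u \<le> p"
      using False low CA by (force simp: A_def intro: order_trans)
    ultimately show ?thesis using low by (auto simp: A_def)
  qed
  obtain m where m: "sublinear m" "m \<le> p" and min: "\<And>q. q \<in> A \<Longrightarrow> q \<le> m \<Longrightarrow> q = m"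
    using predicate_Zorn[OF po ch] by (auto simp: A_def)
  have add: "m (x + y) = m x + m y" for x y
  proof -
    define r where "r = (\<lambda>x. INF t\<in>{0..}. m (x + t *\<^sub>R y) - t * m y)"
    note r = sublinear_directional[OF m(1) r_def]
    have "r \<le> m" using r(2)[of 0] by (simp add: le_fun_def)
    then have "r = m" using min[of r] r(1) m(2) by (auto simp: A_def)
    then have "m x \<le> m (x + y) - m y" using r(2)[of 1 x] by simp
    then show ?thesis using sublinear_add[OF m(1), of x y] by simp
  qed
  have neg: "m (- x) = - m x" for x
    using add[of x "- x"] sublinear_zero[OF m(1)] by simp
  have pos: "m (c *\<^sub>R x) = c * m x" if "0 \<le> c" for c x
    using sublinear_scale[OF m(1) that] sublinear_scale_ge[OF m(1) that] by (simp add: antisym)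
  have "m (c *\<^sub>R x) = c * m x" for c x
    using pos[of c x] pos[of "- c" "x"] neg[of "c *\<^sub>R x"] by (cases "0 \<le> c") auto
  then have "linear m" using add by (intro linearI) auto
  then show ?thesis using m(2) that by (auto simp: le_fun_def)
qed

text \<open>
  The infimal convolution \<open>p y = INF (L * norm (y - z) + k)\<close> over the cone is sublinear and lies below
  both \<open>L * norm\<close> (take the apex) and the height \<open>k\<close> over each \<open>z\<close>; the hypothesis on the cone keeps it
  finite. Every linear functional below \<open>p\<close> satisfies both bounds.
\<close>
lemma cone_minorant:
  fixes K :: "('a::real_normed_vector \<times> real) set"
  assumes add: "\<And>x y. x \<in> K \<Longrightarrow> y \<in> K \<Longrightarrow> x + y \<in> K"
    and scale: "\<And>c x. x \<in> K \<Longrightarrow> 0 \<le> c \<Longrightarrow> c *\<^sub>R x \<in> K"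
    and ne: "K \<noteq> {}" and L: "0 \<le> L"
    and low: "\<And>z k. (z, k) \<in> K \<Longrightarrow> - L * norm z \<le> k"
  obtains f :: "'a \<Rightarrow>\<^sub>L real" where "norm f \<le> L" and "\<And>z k. (z, k) \<in> K \<Longrightarrow> f z \<le> k"
proof -
  have zero: "(0, 0) \<in> K"
    using ne scale[of _ 0] by (force simp: zero_prod_def)
  define p where "p y = (INF w\<in>K. L * norm (y - fst w) + snd w)" for y
  have bdd: "bdd_below ((\<lambda>w. L * norm (y - fst w) + snd w) ` K)" for y
  proof (rule bdd_belowI2)
    fix w assume "w \<in> K"
    then have "- L * norm (fst w) \<le> snd w" using low[of "fst w" "snd w"] by simp
    moreover have "L * norm (fst w) \<le> L * (norm y + norm (y - fst w))"
      using L norm_triangle_ineq2[of "fst w" y] by (intro mult_left_mono) (auto simp: norm_minus_commute)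
    ultimately show "- L * norm y \<le> L * norm (y - fst w) + snd w" by (simp add: algebra_simps)
  qed
  have p_le: "p y \<le> L * norm (y - z) + k" if "(z, k) \<in> K" for y z k
    unfolding p_def using cINF_lower[OF bdd that] by simp
  have p_ge: "a \<le> p y" if "\<And>z k. (z, k) \<in> K \<Longrightarrow> a \<le> L * norm (y - z) + k" for a y
    unfolding p_def using that ne by (intro cINF_greatest) auto
  have "sublinear p"
    unfolding sublinear_def
  proof (intro conjI allI impI)
    fix x y
    have "p (x + y) \<le> (L * norm (x - z) + k) + (L * norm (y - z') + k')"
      if "(z, k) \<in> K" "(z', k') \<in> K" for z k z' k'
    proof -
      have "p (x + y) \<le> L * norm (x + y - (z + z')) + (k + k')"
        using add[OF that] by (intro p_le) simp
      also have "L * norm (x + y - (z + z')) \<le> L * (norm (x - z) + norm (y - z'))"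
        using L norm_triangle_ineq[of "x - z" "y - z'"] by (intro mult_left_mono) (auto simp: algebra_simps)
      finally show ?thesis by (simp add: algebra_simps)
    qed
    then have "p (x + y) - (L * norm (x - z) + k) \<le> p y" if "(z, k) \<in> K" for z k
      using that by (intro p_ge) (force simp: algebra_simps)
    then have "p (x + y) - p y \<le> p x"
      by (intro p_ge) (force simp: algebra_simps)
    then show "p (x + y) \<le> p x + p y" by simp
  next
    fix c :: real and x assume c: "0 \<le> c"
    have *: "p (c *\<^sub>R x) \<le> c * (L * norm (x - z) + k)" if "(z, k) \<in> K" for z k
    proof -
      have "p (c *\<^sub>R x) \<le> L * norm (c *\<^sub>R x - c *\<^sub>R z) + c * k"
        using scale[OF that c] by (intro p_le) simp
      also have "c *\<^sub>R x - c *\<^sub>R z = c *\<^sub>R (x - z)" by (simp add: algebra_simps)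
      finally show ?thesis using c by (simp add: distrib_left mult.left_commute)
    qed
    show "p (c *\<^sub>R x) \<le> c * p x"
    proof (cases "c = 0")
      case True with *[OF zero] show ?thesis by simp
    next
      case False
      with c have "0 < c" by simp
      have "p (c *\<^sub>R x) / c \<le> p x"
        using * \<open>0 < c\<close> by (intro p_ge) (simp add: pos_divide_le_eq mult.commute)
      then show ?thesis using \<open>0 < c\<close> by (simp add: field_simps)
    qed
  qed
  then obtain f where f: "linear f" "\<And>x. f x \<le> p x"
    by (rule Hahn_Banach_sublinear) blast
  have up: "f x \<le> L * norm x" for x
    using f(2)[of x] p_le[OF zero, of x] by simp
  have bd: "norm (f x) \<le> L * norm x" for x
    using up[of x] up[of "- x"] linear_neg[OF f(1)] by simp
  then have "bounded_linear f"
    by (intro bounded_linear_intro[where K=L]) (use f(1) in \<open>auto simp: linear_add linear_scale mult.commute\<close>)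
  then have app: "blinfun_apply (Blinfun f) = f"
    by (rule bounded_linear_Blinfun_apply)
  show ?thesis
  proof
    show "norm (Blinfun f) \<le> L"
      using L bd by (intro norm_blinfun_bound) (auto simp: app)
    show "Blinfun f z \<le> k" if "(z, k) \<in> K" for z k
      using f(2)[of z] p_le[OF that, of z] by (simp add: app)
  qed
qed

section \<open>Epigraphs\<close>

text \<open>
  Convexity and closedness of this set encode convexity and lower semicontinuity of \<open>h\<close> without
  arithmetic on extended reals.
\<close>
definition epi :: "('a \<Rightarrow> ereal) \<Rightarrow> ('a \<times> real) set" where
  "epi h = {(x, r). h x \<le> ereal r}"

lemma mem_epi [simp]: "(x, r) \<in> epi h \<longleftrightarrow> h x \<le> ereal r"
  by (simp add: epi_def)

text \<open>
  Reduces a lower bound for an extended real value, which may be infinite, to statements about real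
  points of the epigraph.
\<close>
lemma ereal_leI_epi:
  assumes "\<And>s. y \<le> ereal s \<Longrightarrow> r \<le> s"
  shows "ereal r \<le> y"
proof (rule ccontr)
  assume "\<not> ereal r \<le> y"
  then obtain s where "y < ereal s" "ereal s < ereal r" using ereal_dense2[of y "ereal r"] by (meson not_le)
  then show False using assms[of s] by (simp add: less_imp_le not_less)
qed

lemma epi_convex_comb:
  assumes "convex (epi h)" "h x \<le> ereal a" "h y \<le> ereal b" "0 \<le> u" "0 \<le> v" "u + v = 1"
  shows "h (u *\<^sub>R x + v *\<^sub>R y) \<le> ereal (u * a + v * b)"
  using convexD[OF assms(1), of "(x, a)" "(y, b)" u v] assms(2-) by simp

text \<open>
  Sublevel sets relative to an affine function, as needed for Ekeland's principle applied to a
  function minus a continuous linear one.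
\<close>
lemma closed_sublevel_affine:
  fixes h :: "'a::real_normed_vector \<Rightarrow> ereal" and \<phi> :: "'a \<Rightarrow>\<^sub>L real"
  assumes "closed (epi h)"
  shows "closed {y. h y \<le> ereal (\<phi> y + b)}"
proof -
  have "continuous_on UNIV (\<lambda>y. (y, \<phi> y + b))" by (intro continuous_intros)
  with assms have "closed ((\<lambda>y. (y, \<phi> y + b)) -` epi h)" by (rule closed_vimage)
  also have "(\<lambda>y. (y, \<phi> y + b)) -` epi h = {y. h y \<le> ereal (\<phi> y + b)}" by auto
  finally show ?thesis .
qed

lemma closed_epi_lsc:
  fixes J :: "'a::metric_space \<Rightarrow> ereal"
  assumes "lsc_on UNIV J" shows "closed (epi J)"
  unfolding closed_sequential_limits
proof (intro allI impI)
  fix X and l :: "'a \<times> real" assume X: "(\<forall>n. X n \<in> epi J) \<and> X \<longlonglongrightarrow> l"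
  obtain x r where l: "l = (x, r)" by fastforce
  have lim: "(\<lambda>n. fst (X n)) \<longlonglongrightarrow> x" "(\<lambda>n. snd (X n)) \<longlonglongrightarrow> r"
    using tendsto_fst[of X l] tendsto_snd[of X l] X l by auto
  have mem: "J (fst (X n)) \<le> ereal (snd (X n))" for n
    using X by (metis mem_epi prod.collapse)
  have "J x \<le> ereal r"
  proof (rule ccontr)
    assume "\<not> J x \<le> ereal r"
    then obtain s where s: "ereal r < ereal s" "ereal s < J x"
      using ereal_dense2[of "ereal r" "J x"] by (meson not_le)
    have "\<forall>\<^sub>F y in at x. ereal s < J y"
      using assms s(2) unfolding lsc_on_def by (metis UNIV_I le_Liminf_iff)
    then have "\<forall>\<^sub>F y in nhds x. ereal s < J y"
      using s(2) by (simp add: eventually_nhds_conv_at)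
    then have "\<forall>\<^sub>F n in sequentially. ereal s < J (fst (X n))"
      using lim(1) by (rule eventually_compose_filterlim)
    moreover have "\<forall>\<^sub>F n in sequentially. snd (X n) < s"
      using s(1) lim(2) by (intro order_tendstoD(2)) auto
    ultimately have "\<forall>\<^sub>F n in sequentially. False"
    proof eventually_elim
      case (elim n)
      then show False using mem[of n] by (meson ereal_less_eq(3) le_less_trans less_ereal.simps(1) less_trans not_less_iff_gr_or_eq)
    qed
    then show False by simp
  qed
  then show "l \<in> epi J" by (simp add: l)
qed

lemma ereal_convex_on_iff_epi:
  fixes J :: "'a::real_vector \<Rightarrow> ereal"
  assumes "\<And>x. J x \<noteq> - \<infinity>"
  shows "ereal_convex_on UNIV J \<longleftrightarrow> convex (epi J)"
proof
  assume cvx: "ereal_convex_on UNIV J"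
  show "convex (epi J)"
    unfolding convex_alt
  proof (safe)
    fix x a y b and u :: real
    assume *: "(x, a) \<in> epi J" "(y, b) \<in> epi J" "0 \<le> u" "u \<le> 1"
    have "J ((1 - u) *\<^sub>R x + u *\<^sub>R y) \<le> ereal ((1 - u) * a + u * b)"
    proof (cases "u = 0 \<or> u = 1")
      case True then show ?thesis using * by auto
    next
      case False
      then have "J ((1 - u) *\<^sub>R x + u *\<^sub>R y) \<le> ereal (1 - u) * J x + ereal u * J y"
        using cvx *(3,4) unfolding ereal_convex_on_def by simp
      also have "\<dots> \<le> ereal (1 - u) * ereal a + ereal u * ereal b"
        using * by (intro add_mono ereal_mult_left_mono) auto
      finally show ?thesis by simp
    qed
    then show "(1 - u) *\<^sub>R (x, a) + u *\<^sub>R (y, b) \<in> epi J" by simp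
  qed
next
  assume cvx: "convex (epi J)"
  show "ereal_convex_on UNIV J"
    unfolding ereal_convex_on_def
  proof (intro conjI ballI allI impI)
    fix x y and u v :: real assume uv: "0 < u" "0 < v" "u + v = 1"
    show "J (u *\<^sub>R x + v *\<^sub>R y) \<le> ereal u * J x + ereal v * J y"
    proof (cases "J x = \<infinity> \<or> J y = \<infinity>")
      case True
      then have "ereal u * J x + ereal v * J y = \<infinity>"
        using uv assms by (cases "J x"; cases "J y") auto
      then show ?thesis by (metis ereal_less_eq(1))
    next
      case False
      then obtain a b where ab: "J x = ereal a" "J y = ereal b"
        using assms by (metis ereal_cases)
      then show ?thesis using epi_convex_comb[OF cvx, of x a y b u v] uv by simp
    qed
  qed simp
qed

section \<open>Separation and affine minorants\<close>

text \<open>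
  A convex function above the concave cone \<open>c + \<phi> - L * norm\<close> with vertex over \<open>x\<close> is separated from it
  by an affine function through the vertex. After subtracting \<open>\<phi>\<close> and moving the vertex to the origin,
  scaling the epigraph by nonnegative factors preserves the lower bound \<open>- L * norm\<close>, because that bound
  is positively homogeneous; so the functional can be taken from the convex cone that the epigraph
  generates.
\<close>
lemma sandwich:
  fixes h :: "'a::real_normed_vector \<Rightarrow> ereal"
  assumes cvx: "convex (epi h)" and L: "0 \<le> L"
    and low: "\<And>y. ereal (c + blinfun_apply \<phi> (y - x) - L * norm (y - x)) \<le> h y"
  obtains f :: "'a \<Rightarrow>\<^sub>L real" where "norm (f - \<phi>) \<le> L" and "\<And>y. ereal (c + f (y - x)) \<le> h y"
proof -
  define E where "E = (\<lambda>(y, s). (y - x, s - c - \<phi> (y - x))) ` epi h"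
  define K where "K = insert 0 (cone hull E)"
  have E_low: "- L * norm z \<le> k" if zk: "(z, k) \<in> E" for z k
  proof -
    obtain y s where ys: "h y \<le> ereal s" "z = y - x" "k = s - c - \<phi> (y - x)"
      using zk unfolding E_def by fastforce
    have "c + \<phi> (y - x) - L * norm (y - x) \<le> s"
      using order_trans[OF low ys(1)] by simp
    then show ?thesis using ys by simp
  qed
  have "E = (\<lambda>v. v - (x, c - \<phi> x)) ` ((\<lambda>(y, s). (y, s - \<phi> y)) ` epi h)"
    unfolding E_def image_image by (intro image_cong) (auto simp: blinfun.diff_right)
  moreover have "linear (\<lambda>(y, s). (y, s - blinfun_apply \<phi> y))"
    by (intro linearI) (auto simp: blinfun.add_right blinfun.scaleR_right algebra_simps)
  ultimately have "convex E"
    using cvx by (simp add: convex_linear_image convex_translation_subtract)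
  then have "convex (cone hull E) \<and> cone (cone hull E)"
    by (simp add: convex_cone_hull cone_cone_hull)
  note cc = this[unfolded convex_cone]
  have add: "u + v \<in> K" if "u \<in> K" "v \<in> K" for u v
    using that cc unfolding K_def by auto
  have scale: "t *\<^sub>R u \<in> K" if "u \<in> K" "0 \<le> t" for u t
    using that cc unfolding K_def by auto
  have K_low: "- L * norm z \<le> k" if zk: "(z, k) \<in> K" for z k
  proof (cases "(z, k) = 0")
    case True then show ?thesis by (simp add: zero_prod_def)
  next
    case False
    then obtain t z' k' where t: "0 \<le> t" "(z', k') \<in> E" "z = t *\<^sub>R z'" "k = t * k'"
      using zk unfolding K_def cone_hull_expl by auto
    then show ?thesis
      using mult_left_mono[OF E_low[OF t(2)] t(1)] by (simp add: algebra_simps)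
  qed
  obtain g :: "'a \<Rightarrow>\<^sub>L real" where g: "norm g \<le> L" "\<And>z k. (z, k) \<in> K \<Longrightarrow> g z \<le> k"
    using cone_minorant[of K L] add scale K_low L unfolding K_def by blast
  show ?thesis
  proof
    show "norm ((\<phi> + g) - \<phi>) \<le> L" using g(1) by simp
    show "ereal (c + (\<phi> + g) (y - x)) \<le> h y" for y
    proof (rule ereal_leI_epi)
      fix s assume "h y \<le> ereal s"
      then have "(y - x, s - c - \<phi> (y - x)) \<in> E" by (force simp: E_def)
      then have "(y - x, s - c - \<phi> (y - x)) \<in> K" using hull_subset[of E cone] by (auto simp: K_def)
      from g(2)[OF this] show "c + (\<phi> + g) (y - x) \<le> s" by (simp add: blinfun.add_left)
    qed
  qed
qed

text \<open>
  A subgradient of the norm at \<open>x\<close>, obtained from the reverse triangle inequality.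
\<close>
lemma norming_functional:
  fixes x :: "'a::real_normed_vector"
  obtains f :: "'a \<Rightarrow>\<^sub>L real" where "norm f \<le> 1" and "f x = norm x"
proof -
  have "epi (\<lambda>y::'a. ereal (norm y)) = epigraph UNIV norm"
    by (auto simp: epigraph_def)
  then have cvx: "convex (epi (\<lambda>y::'a. ereal (norm y)))"
    using convex_on_dist[of UNIV 0] by (simp add: convex_epigraph)
  have "norm x + blinfun_apply 0 (y - x) - 1 * norm (y - x) \<le> norm y" for y
    using norm_triangle_ineq2[of x y] by (simp add: norm_minus_commute)
  then obtain f :: "'a \<Rightarrow>\<^sub>L real" where f: "norm f \<le> 1" "\<And>y. norm x + f (y - x) \<le> norm y"
    using sandwich[OF cvx, of 1 "norm x" 0 x] by auto
  have "norm x \<le> f x" using f(2)[of 0] by (simp add: blinfun.minus_right)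
  moreover have "f x \<le> norm f * norm x" using norm_blinfun[of f x] by simp
  moreover have "norm f * norm x \<le> 1 * norm x" using f(1) by (intro mult_right_mono) auto
  ultimately show ?thesis using f(1) that by force
qed

text \<open>
  The Fenchel-Moreau theorem, stated at a point: affine minorants come arbitrarily close to \<open>h x\<close>,
  also when \<open>h x\<close> is infinite. It suffices to find a cone below \<open>h\<close> with vertex at height \<open>c\<close> over \<open>x\<close>.
  Near \<open>x\<close> lower semicontinuity gives \<open>h > c\<close>. Far from \<open>x\<close> a steep slope is enough, provided
  \<open>h\<close> decreases at most linearly; this global bound follows by convexity from the local
  lower bound at a point \<open>x1\<close> of finite value.
\<close>
lemma affine_minorant:
  fixes h :: "'a::real_normed_vector \<Rightarrow> ereal"
  assumes cvx: "convex (epi h)" and closed: "closed (epi h)" and proper: "proper_fun h"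
    and c: "ereal c < h x"
  obtains f :: "'a \<Rightarrow>\<^sub>L real" where "\<And>y. ereal (c + f (y - x)) \<le> h y"
proof -
  have near: "\<exists>d>0. \<forall>y. norm (y - z) < d \<longrightarrow> ereal b < h y" if "ereal b < h z" for z b
  proof -
    have "open (- {y. h y \<le> ereal (blinfun_apply 0 y + b)})"
      using closed_sublevel_affine[OF closed, of 0 b] by (simp add: open_Compl)
    moreover have "z \<in> - {y. h y \<le> ereal (blinfun_apply 0 y + b)}" using that by simp
    ultimately obtain d where "0 < d" "ball z d \<subseteq> - {y. h y \<le> ereal (blinfun_apply 0 y + b)}"
      using openE by blast
    then show ?thesis by (intro exI[of _ d]) (auto simp: subset_iff dist_norm norm_minus_commute not_le)
  qed
  obtain x1 a1 where x1: "h x1 = ereal a1"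
    using proper unfolding proper_fun_def by (metis ereal_cases less_irrefl)
  obtain d1 where d1: "0 < d1" "\<And>y. norm (y - x1) < d1 \<Longrightarrow> ereal (a1 - 1) < h y"
    using near[of "a1 - 1" x1] x1 by auto
  define L1 where "L1 = 2 / d1"
  have L1: "0 < L1" using d1 by (simp add: L1_def)
  have glob: "ereal (a1 - 1 - L1 * norm (y - x1)) \<le> h y" for y
  proof (cases "norm (y - x1) < d1")
    case True
    have "0 \<le> L1 * norm (y - x1)" using L1 by simp
    then have "ereal (a1 - 1 - L1 * norm (y - x1)) \<le> ereal (a1 - 1)" by simp
    then show ?thesis using d1(2)[OF True] by (meson less_imp_le order_trans)
  next
    case False
    define n where "n = norm (y - x1)"
    have n: "0 < n" "d1 \<le> n" using False d1(1) by (auto simp: n_def)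
    \<comment> \<open>Puts the combination at distance \<open>d1 / 2\<close> from \<open>x1\<close>, inside the ball of the local bound.\<close>
    define t where "t = d1 / (2 * n)"
    have t: "0 < t" "t \<le> 1" "t * n = d1 / 2" using n d1(1) by (auto simp: t_def field_simps)
    show ?thesis
    proof (rule ereal_leI_epi)
      fix s assume s: "h y \<le> ereal s"
      have "h ((1 - t) *\<^sub>R x1 + t *\<^sub>R y) \<le> ereal ((1 - t) * a1 + t * s)"
        using t x1 s by (intro epi_convex_comb[OF cvx]) auto
      moreover have "(1 - t) *\<^sub>R x1 + t *\<^sub>R y - x1 = t *\<^sub>R (y - x1)" by (simp add: algebra_simps)
      then have "norm ((1 - t) *\<^sub>R x1 + t *\<^sub>R y - x1) < d1" using t d1(1) by (simp add: n_def)
      from d1(2)[OF this] have "ereal (a1 - 1) < h ((1 - t) *\<^sub>R x1 + t *\<^sub>R y)" .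
      ultimately have "ereal (a1 - 1) < ereal ((1 - t) * a1 + t * s)" by (rule less_le_trans[rotated])
      then have "t * a1 - 1 < t * s" by (simp add: algebra_simps)
      then have "a1 - 1 / t < s" using t(1) by (simp add: field_simps)
      moreover have "1 / t = L1 * n" using n d1 by (simp add: t_def L1_def)
      ultimately show "a1 - 1 - L1 * norm (y - x1) \<le> s" by (simp add: n_def)
    qed
  qed
  \<comment> \<open>The same cone bound with the vertex moved from \<open>x1\<close> to \<open>x\<close>.\<close>
  define A where "A = a1 - 1 - L1 * norm (x - x1)"
  have globx: "ereal (A - L1 * norm (y - x)) \<le> h y" for y
  proof -
    have "L1 * norm (y - x1) \<le> L1 * (norm (y - x) + norm (x - x1))"
      using L1 norm_triangle_ineq[of "y - x" "x - x1"] by (intro mult_left_mono) auto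
    then have "ereal (A - L1 * norm (y - x)) \<le> ereal (a1 - 1 - L1 * norm (y - x1))"
      by (simp add: A_def algebra_simps)
    then show ?thesis using glob order_trans by blast
  qed
  obtain d where d: "0 < d" "\<And>y. norm (y - x) < d \<Longrightarrow> ereal c < h y"
    using near[OF c] by blast
  \<comment> \<open>Steep enough to go from height \<open>c\<close> to below the cone of height \<open>A\<close> within distance \<open>d\<close>.\<close>
  define L where "L = L1 + \<bar>c - A\<bar> / d"
  have L: "0 \<le> L" using L1 d by (simp add: L_def)
  have low: "ereal (c + blinfun_apply 0 (y - x) - L * norm (y - x)) \<le> h y" for y
  proof (cases "norm (y - x) < d")
    case True
    have "0 \<le> L * norm (y - x)" using L by simp
    then have "ereal (c + blinfun_apply 0 (y - x) - L * norm (y - x)) \<le> ereal c" by simp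
    then show ?thesis using d(2)[OF True] by (meson less_imp_le order_trans)
  next
    case False
    then have "\<bar>c - A\<bar> / d * d \<le> \<bar>c - A\<bar> / d * norm (y - x)"
      using d(1) by (intro mult_left_mono) auto
    then have "c - A \<le> \<bar>c - A\<bar> / d * norm (y - x)" using d(1) by simp
    then have "ereal (c + blinfun_apply 0 (y - x) - L * norm (y - x)) \<le> ereal (A - L1 * norm (y - x))"
      by (simp add: L_def algebra_simps)
    then show ?thesis using globx order_trans by blast
  qed
  then show ?thesis using sandwich[OF cvx L low] that by blast
qed

section \<open>Existence of subgradients\<close>

lemma mem_subdifferential:
  assumes "h x = ereal a"
  shows "f \<in> subdifferential h x \<longleftrightarrow> (\<forall>y. ereal (a + blinfun_apply f (y - x)) \<le> h y)"
  using assms by (simp add: subdifferential_def)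

lemma in_subdifferentialE:
  assumes "f \<in> subdifferential h x"
  obtains a where "h x = ereal a" and "\<And>y. ereal (a + blinfun_apply f (y - x)) \<le> h y"
proof (cases "h x")
  case (real a)
  with assms that show ?thesis by (simp add: mem_subdifferential[of h x a])
qed (use assms in \<open>auto simp: subdifferential_def\<close>)

text \<open>
  The variational principle of Ekeland. Call \<open>z\<close> reachable from \<open>x\<close> if passing from \<open>x\<close> to \<open>z\<close> lowers
  \<open>r\<close> by at least \<open>e\<close> times the distance; this relation is a preorder. A sequence that moves each time to
  a nearly optimal reachable point is Cauchy, since its steps are paid for by the decrease of \<open>r\<close>, and
  from its limit no reachable point has a smaller value.
\<close>
lemma Ekeland:
  fixes r :: "'a::complete_space \<Rightarrow> real"
  assumes closed: "\<And>b. closed {x\<in>S. r x \<le> b}" and bdd: "\<And>x. x \<in> S \<Longrightarrow> m \<le> r x"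
    and x0: "x0 \<in> S" and e: "0 < e"
  obtains x where "x \<in> S" and "r x + e * dist x0 x \<le> r x0"
    and "\<And>y. y \<in> S \<Longrightarrow> r x \<le> r y + e * dist x y"
proof -
  define T where "T x = {y\<in>S. r y + e * dist x y \<le> r x}" for x
  have refl: "x \<in> T x" if "x \<in> S" for x using that by (simp add: T_def)
  have trans: "T y \<subseteq> T x" if "y \<in> T x" for x y
  proof
    fix z assume "z \<in> T y"
    with that have "z \<in> S" "r z + e * (dist x y + dist y z) \<le> r x"
      by (auto simp: T_def algebra_simps)
    moreover have "e * dist x z \<le> e * (dist x y + dist y z)"
      using e dist_triangle[of x z y] by simp
    ultimately show "z \<in> T x" unfolding T_def by simp
  qed
  have "\<exists>y\<in>T x. \<forall>z\<in>T x. r y < r z + (1/2) ^ n" if "x \<in> S" for x and n :: nat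
  proof -
    have ne: "r ` T x \<noteq> {}" using refl[OF that] by auto
    have bb: "bdd_below (r ` T x)" using bdd by (intro bdd_belowI2[where m=m]) (auto simp: T_def)
    have "Inf (r ` T x) < Inf (r ` T x) + (1/2) ^ n" by simp
    then obtain y where "y \<in> T x" "r y < Inf (r ` T x) + (1/2) ^ n"
      using cInf_less_iff[OF ne bb] by (metis imageE)
    then show ?thesis using cInf_lower[OF _ bb] by (force intro!: bexI[of _ y])
  qed
  then obtain G where G: "\<And>x n. x \<in> S \<Longrightarrow> G x n \<in> T x"
    "\<And>x n z. x \<in> S \<Longrightarrow> z \<in> T x \<Longrightarrow> r (G x n) < r z + (1/2) ^ (n::nat)"
    by metis
  \<comment> \<open>Each step leaves at most \<open>(1/2) ^ n\<close> of the attainable decrease unused.\<close>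
  define X where "X = rec_nat x0 (\<lambda>n x. G x n)"
  have X0: "X 0 = x0" and XS: "X (Suc n) = G (X n) n" for n by (simp_all add: X_def)
  have inS: "X n \<in> S" for n
    by (induction n) (use x0 G(1) in \<open>auto simp: X0 XS T_def\<close>)
  have step: "X (Suc n) \<in> T (X n)" for n using G(1)[OF inS] by (simp add: XS)
  have mono: "X n \<in> T (X k)" if "k \<le> n" for k n
    using that
  proof (induction n rule: dec_induct)
    case base show ?case by (rule refl[OF inS])
  next
    case (step n) then show ?case using trans[of "X n" "X k"] \<open>\<And>n. X (Suc n) \<in> T (X n)\<close> by blast
  qed
  have dec: "decseq (\<lambda>n. r (X n))"
    using step e by (intro decseq_SucI) (fastforce simp: T_def intro: order_trans[rotated])
  obtain \<rho> where \<rho>: "(\<lambda>n. r (X n)) \<longlonglongrightarrow> \<rho>" "\<And>n. \<rho> \<le> r (X n)"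
    using decseq_convergent[OF dec, of m] bdd inS by blast
  have "Cauchy X"
    unfolding Cauchy_altdef2
  proof (intro allI impI)
    fix d :: real assume "0 < d"
    with e have "\<rho> < \<rho> + e * d" by simp
    from order_tendstoD(2)[OF \<rho>(1) this] obtain N where N: "r (X N) < \<rho> + e * d"
      by (auto simp: eventually_sequentially)
    have "dist (X n) (X N) < d" if "N \<le> n" for n
    proof -
      have "r (X n) + e * dist (X N) (X n) \<le> r (X N)" using mono[OF that] by (simp add: T_def)
      then have "e * dist (X N) (X n) < e * d" using \<rho>(2)[of n] N by linarith
      then show ?thesis using e by (simp add: dist_commute)
    qed
    then show "\<exists>N. \<forall>n\<ge>N. dist (X n) (X N) < d" by blast
  qed
  then obtain x where x: "X \<longlonglongrightarrow> x" using Cauchy_convergent convergent_def by blast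
  have near: "x \<in> {z\<in>S. r z \<le> b}" if "\<rho> < b" for b
  proof (rule Lim_in_closed_set[OF closed _ sequentially_bot x])
    show "\<forall>\<^sub>F n in sequentially. X n \<in> {z\<in>S. r z \<le> b}"
      using order_tendstoD(2)[OF \<rho>(1) that] by eventually_elim (simp add: inS)
  qed
  have rx: "x \<in> S \<and> r x \<le> \<rho>"
    using near[of "\<rho> + 1"] near by (auto intro: field_le_epsilon dense_ge)
  have xT: "x \<in> T (X k)" for k
  proof -
    have "\<rho> + e * dist (X k) x \<le> r (X k)"
    proof (rule LIMSEQ_le_const2)
      show "(\<lambda>n. r (X n) + e * dist (X k) (X n)) \<longlonglongrightarrow> \<rho> + e * dist (X k) x"
        by (intro tendsto_intros \<rho>(1) x)
      show "\<exists>N. \<forall>n\<ge>N. r (X n) + e * dist (X k) (X n) \<le> r (X k)"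
        using mono by (auto simp: T_def)
    qed
    then show ?thesis using rx by (simp add: T_def)
  qed
  show ?thesis
  proof
    show "x \<in> S" using rx by blast
    show "r x + e * dist x0 x \<le> r x0" using xT[of 0] by (simp add: X0 T_def)
    fix y assume "y \<in> S"
    show "r x \<le> r y + e * dist x y"
    proof (rule ccontr)
      assume neg: "\<not> ?thesis"
      then have "y \<in> T x" using \<open>y \<in> S\<close> by (simp add: T_def)
      then have "y \<in> T (X n)" for n using trans[OF xT] by blast
      then have "\<rho> \<le> r y + (1/2) ^ n" for n
        using G(2)[OF inS, of y n n] \<rho>(2)[of "Suc n"] by (simp add: XS)
      moreover have "(\<lambda>n. r y + (1/2) ^ n) \<longlonglongrightarrow> r y + 0"
        by (intro tendsto_intros) auto
      ultimately have "\<rho> \<le> r y" using LIMSEQ_le_const[of _ "r y + 0" \<rho>] by auto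
      moreover have "0 \<le> e * dist x y" using e by simp
      ultimately show False using rx neg by linarith
    qed
  qed
qed

text \<open>
  The hypotheses say that \<open>\<phi>\<close> is a \<open>\<delta>\<close>-subgradient of \<open>h\<close> at \<open>y0\<close>. Ekeland's principle for \<open>h - \<phi>\<close> gives
  a point \<open>y\<close> near \<open>y0\<close> where \<open>h - \<phi>\<close> stays above a cone of slope \<open>e\<close>, and a separating
  affine function turns this into an exact subgradient within \<open>e\<close> of \<open>\<phi>\<close>.
\<close>
theorem Bronsted_Rockafellar:
  fixes h :: "'a::banach \<Rightarrow> ereal" and \<phi> :: "'a \<Rightarrow>\<^sub>L real"
  assumes cvx: "convex (epi h)" and closed: "closed (epi h)"
    and low: "\<And>y. ereal (m + \<phi> y) \<le> h y"
    and y0: "h y0 \<le> ereal (m + \<phi> y0 + \<delta>)" and e: "0 < e"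
  obtains y g where "g \<in> subdifferential h y" and "norm (g - \<phi>) \<le> e"
    and "e * norm (y - y0) \<le> \<delta>"
proof -
  \<comment> \<open>On this sublevel set of \<open>h - \<phi>\<close> the values of \<open>h\<close> are real; outside it the cone estimate below is trivial.\<close>
  define S where "S = {y. h y \<le> ereal (\<phi> y + (m + \<delta>))}"
  define r where "r y = real_of_ereal (h y) - \<phi> y" for y
  have hr: "h y = ereal (r y + \<phi> y)" if "y \<in> S" for y
    using that low[of y] by (cases "h y") (auto simp: S_def r_def)
  have r_ge: "m \<le> r y" if "y \<in> S" for y
    using low[of y] hr[OF that] by simp
  have "{y\<in>S. r y \<le> b} = {y. h y \<le> ereal (\<phi> y + min b (m + \<delta>))}" for b
  proof -
    have "h y \<le> ereal (\<phi> y + min b (m + \<delta>)) \<longleftrightarrow> y \<in> S \<and> r y \<le> b" for y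
    proof (cases "y \<in> S")
      case True
      then show ?thesis using hr[OF True] by (auto simp: S_def)
    next
      case False
      then have "\<not> h y \<le> ereal (\<phi> y + (m + \<delta>))" by (simp add: S_def)
      then show ?thesis using False
        by (meson add_left_mono ereal_less_eq(3) min.cobounded2 order_trans)
    qed
    then show ?thesis by auto
  qed
  then have cl: "closed {y\<in>S. r y \<le> b}" for b
    using closed_sublevel_affine[OF closed] by simp
  have y0S: "y0 \<in> S" using y0 by (simp add: S_def algebra_simps)
  obtain y where y: "y \<in> S" "r y + e * dist y0 y \<le> r y0"
    and min: "\<And>z. z \<in> S \<Longrightarrow> r y \<le> r z + e * dist y z"
    using Ekeland[of S r, OF cl r_ge y0S e] by blast
  have ry0: "r y0 \<le> m + \<delta>" using y0 hr[OF y0S] by simp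
  have "0 \<le> e * dist y0 y" using e by simp
  then have ry: "r y \<le> m + \<delta>" using y(2) ry0 by linarith
  have "ereal ((r y + \<phi> y) + \<phi> (z - y) - e * norm (z - y)) \<le> h z" for z
  proof (cases "z \<in> S")
    case True
    then show ?thesis using min[OF True] hr[OF True]
      by (simp add: blinfun.diff_right dist_norm norm_minus_commute)
  next
    case False
    have "0 \<le> e * norm (z - y)" using e by simp
    then have "(r y + \<phi> y) + \<phi> (z - y) - e * norm (z - y) \<le> \<phi> z + (m + \<delta>)"
      using ry by (simp add: blinfun.diff_right)
    then have "ereal ((r y + \<phi> y) + \<phi> (z - y) - e * norm (z - y)) \<le> ereal (\<phi> z + (m + \<delta>))" by simp
    also have "\<dots> \<le> h z" using False by (simp add: S_def)
    finally show ?thesis .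
  qed
  then obtain g :: "'a \<Rightarrow>\<^sub>L real" where g: "norm (g - \<phi>) \<le> e" "\<And>z. ereal ((r y + \<phi> y) + g (z - y)) \<le> h z"
    using sandwich[OF cvx, of e "r y + \<phi> y" \<phi> y] e by auto
  show ?thesis
  proof
    show "g \<in> subdifferential h y" using g(2) using mem_subdifferential[of h y, OF hr[OF y(1)]] by blast
    show "norm (g - \<phi>) \<le> e" by (rule g(1))
    show "e * norm (y - y0) \<le> \<delta>"
      using y(2) ry0 r_ge[OF y(1)] by (simp add: dist_norm norm_minus_commute)
  qed
qed

text \<open>
  The point \<open>x\<close> lies between \<open>y\<close> and the point \<open>w\<close> at distance \<open>\<rho>\<close> from \<open>x\<close> in the direction opposite
  to \<open>y\<close>. Since \<open>h w \<le> M\<close>, a small value at \<open>y\<close> would make the value at \<open>x\<close> too small.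
\<close>
lemma bounded_above_lipschitz_below:
  fixes h :: "'a::real_normed_vector \<Rightarrow> ereal"
  assumes cvx: "convex (epi h)" and \<rho>: "0 < \<rho>" and hx: "ereal a \<le> h x"
    and up: "\<And>w. norm (w - x) \<le> \<rho> \<Longrightarrow> h w \<le> ereal M"
  shows "ereal (a - (M - a) / \<rho> * norm (y - x)) \<le> h y"
proof (cases "y = x")
  case True then show ?thesis using hx by simp
next
  case False
  define d where "d = norm (y - x)"
  define w where "w = x - (\<rho> / d) *\<^sub>R (y - x)"
  have d: "0 < d" using False by (simp add: d_def)
  have "norm (w - x) = \<rho>" using d \<rho> by (simp add: w_def d_def)
  then have w: "h w \<le> ereal M" using up by simp
  show ?thesis
  proof (rule ereal_leI_epi)
    fix s assume "h y \<le> ereal s"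
    \<comment> \<open>The weights that make \<open>x\<close> the combination of \<open>y\<close> and \<open>w\<close>.\<close>
    define u where "u = \<rho> / (\<rho> + d)"
    define v where "v = d / (\<rho> + d)"
    have uv: "0 \<le> u" "0 \<le> v" "u + v = 1" 
      using d \<rho> by (auto simp: u_def v_def add_divide_distrib[symmetric])
    have "v * (\<rho> / d) = u" using d \<rho> by (simp add: u_def v_def)
    then have "u *\<^sub>R y + v *\<^sub>R w = (u + v) *\<^sub>R x"
      by (simp add: w_def algebra_simps)
    then have *: "h x \<le> ereal (u * s + v * M)"
      using epi_convex_comb[OF cvx \<open>h y \<le> ereal s\<close> w uv] uv(3) by simp
    then have "a \<le> u * s + v * M" using order_trans[OF hx *] by simp
    also have "\<dots> = (\<rho> * s + d * M) / (\<rho> + d)" by (simp add: u_def v_def add_divide_distrib)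
    finally have "a * (\<rho> + d) \<le> \<rho> * s + d * M" using d \<rho> by (simp add: pos_le_divide_eq)
    then have "a * \<rho> - (M - a) * d \<le> \<rho> * s" by (simp add: algebra_simps)
    then have "(a * \<rho> - (M - a) * d) / \<rho> \<le> s" using \<rho> by (simp add: pos_divide_le_eq mult.commute)
    then show "a - (M - a) / \<rho> * norm (y - x) \<le> s"
      using \<rho> by (simp add: d_def field_simps)
  qed
qed

lemma subdifferentiable_if_bounded_above:
  fixes h :: "'a::real_normed_vector \<Rightarrow> ereal"
  assumes cvx: "convex (epi h)" and \<rho>: "0 < \<rho>" and hx: "h x = ereal a"
    and up: "\<And>w. norm (w - x) \<le> \<rho> \<Longrightarrow> h w \<le> ereal M"
  shows "subdifferential h x \<noteq> {}"
proof -
  define L where "L = (M - a) / \<rho>"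
  have "a \<le> M" using up[of x] hx \<rho> by simp
  then have L: "0 \<le> L" using \<rho> by (simp add: L_def)
  have low: "ereal (a + blinfun_apply 0 (y - x) - L * norm (y - x)) \<le> h y" for y
    using bounded_above_lipschitz_below[OF cvx \<rho>, of a x M y] hx up by (simp add: L_def)
  then obtain f :: "'a \<Rightarrow>\<^sub>L real" where "\<And>y. ereal (a + f (y - x)) \<le> h y"
    using sandwich[OF cvx L low] by blast
  then show ?thesis using mem_subdifferential[of h x, OF hx] by blast
qed

section \<open>Conjugates and the bidual\<close>

text \<open>
  For fixed \<open>\<phi>\<close> and \<open>c\<close> this is a closed half-space, everything or nothing. Epigraphs of conjugates are
  intersections of such sets.
\<close>
lemma convex_closed_minorants:
  fixes \<phi> :: "'a::real_normed_vector \<Rightarrow>\<^sub>L real"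
  shows "convex {(y, b). ereal (\<phi> y - b) \<le> c}" and "closed {(y, b). ereal (\<phi> y - b) \<le> c}"
proof -
  have "convex {(y, b). ereal (\<phi> y - b) \<le> c} \<and> closed {(y, b). ereal (\<phi> y - b) \<le> c}"
  proof (cases c)
    case (real r)
    have lin: "linear (\<lambda>(y, b). \<phi> y - b)"
      by (intro linearI) (auto simp: blinfun.add_right blinfun.scaleR_right algebra_simps)
    have eq: "{(y, b). ereal (\<phi> y - b) \<le> c} = (\<lambda>(y, b). \<phi> y - b) -` {..r}"
      using real by auto
    have "closed ((\<lambda>z. \<phi> (fst z) - snd z) -` {..r})"
      by (intro closed_vimage continuous_intros)
    then show ?thesis
      unfolding eq using convex_linear_vimage[OF lin, of "{..r}"] by (simp add: case_prod_beta')
  qed auto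
  then show "convex {(y, b). ereal (\<phi> y - b) \<le> c}" "closed {(y, b). ereal (\<phi> y - b) \<le> c}"
    by auto
qed

text \<open>
  Conjugation as a statement about affine minorants: \<open>J\<^sup>* f \<le> b\<close> holds iff \<open>f - b\<close> lies below \<open>J\<close>.
\<close>
lemma conjugate_le_iff: "conjugate J f \<le> ereal b \<longleftrightarrow> (\<forall>u. ereal (f u - b) \<le> J u)"
proof -
  have "ereal (f u) - J u \<le> ereal b \<longleftrightarrow> ereal (f u - b) \<le> J u" for u
    by (cases "J u") auto
  then show ?thesis by (simp add: conjugate_def SUP_le_iff)
qed

lemma Fenchel_Young:
  assumes "J x \<le> ereal a" shows "ereal (blinfun_apply f x - a) \<le> conjugate J f"
proof (rule ereal_leI_epi)
  fix b assume "conjugate J f \<le> ereal b"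
  then have "ereal (f x - b) \<le> J x" by (simp add: conjugate_le_iff)
  also note assms
  finally show "f x - a \<le> b" by simp
qed

definition bidual_embedding :: "'a::real_normed_vector \<Rightarrow> (('a \<Rightarrow>\<^sub>L real) \<Rightarrow>\<^sub>L real)" where
  "bidual_embedding x = Blinfun (\<lambda>f. blinfun_apply f x)"

lemma bidual_embedding_apply [simp]: "bidual_embedding x f = blinfun_apply f x"
  unfolding bidual_embedding_def by (subst bounded_linear_Blinfun_apply) auto

lemma convex_closed_epi_conjugate:
  fixes J :: "'a::real_normed_vector \<Rightarrow> ereal"
  shows "convex (epi (conjugate J))" and "closed (epi (conjugate J))"
proof -
  have "epi (conjugate J) = (\<Inter>u. {(f, b). ereal (bidual_embedding u f - b) \<le> J u})"
    by (auto simp: conjugate_le_iff)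
  then show "convex (epi (conjugate J))" "closed (epi (conjugate J))"
    by (simp_all only:) (intro convex_INT closed_INT ballI convex_closed_minorants)+
qed

lemma bidual_embedding_diff: "bidual_embedding (x - y) = bidual_embedding x - bidual_embedding y"
  by (rule blinfun_eqI) (simp add: blinfun.diff_right blinfun.diff_left)

text \<open>
  Distances in the bidual control distances in the space; this brings the estimate of the
  Bronsted-Rockafellar theorem for \<open>J\<^sup>*\<close> back to the original space.
\<close>
lemma norm_bidual_embedding_ge: "norm x \<le> norm (bidual_embedding x)"
proof -
  obtain f :: "'a \<Rightarrow>\<^sub>L real" where f: "norm f \<le> 1" "f x = norm x"
    by (rule norming_functional)
  have "norm x \<le> norm (bidual_embedding x) * norm f"
    using norm_blinfun[of "bidual_embedding x" f] f(2) by simp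
  also have "\<dots> \<le> norm (bidual_embedding x) * 1" using f(1) by (intro mult_left_mono) auto
  finally show ?thesis by simp
qed

text \<open>
  For any \<open>J\<close>, subgradients invert into subgradients of the conjugate, with equality in the
  Fenchel-Young inequality. The converse needs either convexity or a strong minimum.
\<close>
lemma subdifferential_conjugate:
  assumes "f \<in> subdifferential J x"
  shows "bidual_embedding x \<in> subdifferential (conjugate J) f"
    and "conjugate J f = ereal (f x) - J x"
proof -
  obtain a where a: "J x = ereal a" "\<And>u. ereal (a + f (u - x)) \<le> J u"
    using assms by (rule in_subdifferentialE) blast
  have "conjugate J f \<le> ereal (f x - a)"
    using a(2) by (simp add: conjugate_le_iff blinfun.diff_right algebra_simps)
  then have eq: "conjugate J f = ereal (f x - a)"
    using Fenchel_Young[of J x a f] a(1) by (intro antisym) auto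
  then show "conjugate J f = ereal (f x) - J x" using a(1) by simp
  have "ereal (f x - a + bidual_embedding x (g - f)) \<le> conjugate J g" for g
    using Fenchel_Young[of J x a g] a(1) by (simp add: blinfun.diff_left)
  then show "bidual_embedding x \<in> subdifferential (conjugate J) f"
    using mem_subdifferential[of "conjugate J" f, OF eq] by blast
qed

text \<open>
  If \<open>J x\<close> exceeded \<open>f x - J\<^sup>* f\<close>, an affine minorant of \<open>J\<close> with slope \<open>g\<close> passing above that value
  at \<open>x\<close> would make \<open>J\<^sup>* g\<close> too small for \<open>x\<close> to be a subgradient of \<open>J\<^sup>*\<close> at \<open>f\<close>.
\<close>
lemma bidual_subgradient_reflects:
  assumes cvx: "convex (epi J)" and closed: "closed (epi J)" and proper: "proper_fun J"
    and F: "bidual_embedding x \<in> subdifferential (conjugate J) f"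
  shows "f \<in> subdifferential J x"
proof -
  obtain v where v: "conjugate J f = ereal v"
    "\<And>g. ereal (v + bidual_embedding x (g - f)) \<le> conjugate J g"
    using F by (rule in_subdifferentialE) blast
  have low: "ereal (f u - v) \<le> J u" for u
    using v(1) conjugate_le_iff[of J f v] by simp
  have "J x \<le> ereal (f x - v)"
  proof (rule ccontr)
    assume "\<not> ?thesis"
    then obtain c where c: "ereal (f x - v) < ereal c" "ereal c < J x"
      using ereal_dense2[of "ereal (f x - v)" "J x"] by (meson not_le)
    obtain g :: "'a \<Rightarrow>\<^sub>L real" where g: "\<And>u. ereal (c + g (u - x)) \<le> J u"
      using affine_minorant[OF cvx closed proper c(2)] by blast
    have "conjugate J g \<le> ereal (g x - c)"
      using g by (simp add: conjugate_le_iff blinfun.diff_right algebra_simps)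
    from order_trans[OF v(2) this] c(1) show False by (simp add: blinfun.diff_left)
  qed
  then have eq: "J x = ereal (f x - v)" using low[of x] by (intro antisym)
  show ?thesis
    using mem_subdifferential[of J x, OF eq] low by (simp add: blinfun.diff_right)
qed

text \<open>
  An affine minorant of \<open>J\<close> makes \<open>J\<^sup>*\<close> finite somewhere, and a point of finite value of \<open>J\<close> gives a
  continuous affine minorant of \<open>J\<^sup>*\<close>; together they provide an approximate subgradient of \<open>J\<^sup>*\<close>.
\<close>
lemma dom_subdifferential_conjugate_nonempty:
  fixes J :: "'a::real_normed_vector \<Rightarrow> ereal"
  assumes cvx: "convex (epi J)" and closed: "closed (epi J)" and proper: "proper_fun J"
  shows "dom_subdifferential (conjugate J) \<noteq> {}"
proof -
  obtain x a where x: "J x = ereal a"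
    using proper unfolding proper_fun_def by (metis ereal_cases less_irrefl)
  then have "ereal (a - 1) < J x" by simp
  then obtain f0 :: "'a \<Rightarrow>\<^sub>L real" where f0: "\<And>u. ereal (a - 1 + f0 (u - x)) \<le> J u"
    using affine_minorant[OF cvx closed proper] by blast
  have low: "ereal (- a + bidual_embedding x f) \<le> conjugate J f" for f
    using Fenchel_Young[of J x a f] x by simp
  have "conjugate J f0 \<le> ereal (- a + bidual_embedding x f0 + 1)"
    using f0 by (simp add: conjugate_le_iff blinfun.diff_right algebra_simps)
  then obtain f F where "F \<in> subdifferential (conjugate J) f"
    using Bronsted_Rockafellar[OF convex_closed_epi_conjugate low _ zero_less_one] by blast
  then show ?thesis by (auto simp: dom_subdifferential_def)
qed

section \<open>Strong minima and firm subgradients\<close>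

text \<open>
  The affine function with slope \<open>f\<close> touching \<open>J\<close> at \<open>x\<close> stays uniformly below \<open>J\<close> away from \<open>x\<close>. This is
  the common form of a strong minimum of \<open>J - f\<close> at \<open>x\<close> and, for convex \<open>J\<close>, of the estimate that
  defines firm subdifferentiability.
\<close>
definition strong_subgradient ::
  "('a::real_normed_vector \<Rightarrow> ereal) \<Rightarrow> 'a \<Rightarrow> ('a \<Rightarrow>\<^sub>L real) \<Rightarrow> bool" where
  "strong_subgradient J x f \<longleftrightarrow> f \<in> subdifferential J x \<and>
    (\<forall>\<delta>>0. \<exists>c>0. \<forall>u. \<delta> \<le> norm (u - x) \<longrightarrow> J x + ereal (f (u - x) + c) \<le> J u)"

lemma strong_subgradient_unique:
  assumes x: "strong_subgradient J x f" and y: "f \<in> subdifferential J y"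
  shows "y = x"
proof (rule ccontr)
  assume "y \<noteq> x"
  obtain a where a: "J x = ereal a"
    using x unfolding strong_subgradient_def by (auto elim: in_subdifferentialE)
  obtain b where b: "J y = ereal b" "\<And>u. ereal (b + f (u - y)) \<le> J u"
    using y by (rule in_subdifferentialE) blast
  obtain c where "0 < c" "\<And>u. norm (y - x) \<le> norm (u - x) \<Longrightarrow> J x + ereal (f (u - x) + c) \<le> J u"
    using x \<open>y \<noteq> x\<close> unfolding strong_subgradient_def by (metis right_minus_eq zero_less_norm_iff)
  from this(2)[of y] this(1) show False
    using a b(1) b(2)[of x] by (simp add: blinfun.diff_right)
qed

text \<open>
  If the gap over the complement of some ball around \<open>x\<close> were not bounded away from 0, points with gap
  at most \<open>1 / (n + 1)\<close> outside the ball would form a minimizing sequence that does not converge to \<open>x\<close>.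
\<close>
lemma strong_minimum_iff:
  assumes J: "proper_fun J"
  shows "attains_strong_minimum (\<lambda>x. J x - ereal (blinfun_apply f x)) \<longleftrightarrow> (\<exists>x. strong_subgradient J x f)"
proof
  assume "attains_strong_minimum (\<lambda>x. J x - ereal (f x))"
  then obtain x where x: "\<And>u. J x - ereal (f x) \<le> J u - ereal (f u)"
    and seq: "\<And>X. (\<lambda>n. J (X n) - ereal (f (X n))) \<longlonglongrightarrow> (INF u. J u - ereal (f u)) \<Longrightarrow> X \<longlonglongrightarrow> x"
    unfolding attains_strong_minimum_def by blast
  obtain x1 where "J x1 < \<infinity>" using J by (auto simp: proper_fun_def)
  then obtain a where a: "J x = ereal a"
    using x[of x1] J unfolding proper_fun_def by (cases "J x1"; cases "J x") auto
  have inf: "(INF u. J u - ereal (f u)) = ereal (a - f x)"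
    using x a by (intro antisym INF_lower2[of x] INF_greatest) auto
  have sub: "ereal (a + f (u - x)) \<le> J u" for u
    using x[of u] a by (cases "J u") (auto simp: blinfun.diff_right)
  have "\<exists>c>0. \<forall>u. \<delta> \<le> norm (u - x) \<longrightarrow> J x + ereal (f (u - x) + c) \<le> J u" if "0 < \<delta>" for \<delta>
  proof (rule ccontr)
    assume no: "\<not> ?thesis"
    have "\<exists>u. \<delta> \<le> norm (u - x) \<and> \<not> J x + ereal (f (u - x) + inverse (real (Suc n))) \<le> J u" for n
      using no by (metis inverse_positive_iff_positive of_nat_0_less_iff zero_less_Suc)
    then obtain X where X: "\<And>n. \<delta> \<le> norm (X n - x)"
      "\<And>n. \<not> J x + ereal (f (X n - x) + inverse (real (Suc n))) \<le> J (X n)"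
      by metis
    have "(\<lambda>n. J (X n) - ereal (f (X n))) \<longlonglongrightarrow> ereal (a - f x)"
    proof (rule tendsto_sandwich)
      show "\<forall>\<^sub>F n in sequentially. ereal (a - f x) \<le> J (X n) - ereal (f (X n))"
        using x a by (intro always_eventually) (metis ereal_minus(1))
      have "J (X n) - ereal (f (X n)) \<le> ereal (a - f x + inverse (real (Suc n)))" for n
        using X(2)[of n] a by (cases "J (X n)") (auto simp: blinfun.diff_right)
      then show "\<forall>\<^sub>F n in sequentially. J (X n) - ereal (f (X n)) \<le> ereal (a - f x + inverse (real (Suc n)))"
        by (intro always_eventually) blast
      have "(\<lambda>n. a - f x + inverse (real (Suc n))) \<longlonglongrightarrow> a - f x + 0"
        by (intro tendsto_intros LIMSEQ_inverse_real_of_nat)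
      then show "(\<lambda>n. ereal (a - f x + inverse (real (Suc n)))) \<longlonglongrightarrow> ereal (a - f x)"
        by simp
    qed simp
    then have "X \<longlonglongrightarrow> x" using seq inf by simp
    then obtain n where "norm (X n - x) < \<delta>"
      using \<open>0 < \<delta>\<close> by (meson LIMSEQ_iff order_refl)
    then show False using X(1)[of n] by simp
  qed
  then have "strong_subgradient J x f"
    unfolding strong_subgradient_def using mem_subdifferential[of J x, OF a] sub by blast
  then show "\<exists>x. strong_subgradient J x f" by blast
next
  assume "\<exists>x. strong_subgradient J x f"
  then obtain x where x: "strong_subgradient J x f" by blast
  then obtain a where a: "J x = ereal a" "\<And>u. ereal (a + f (u - x)) \<le> J u"
    unfolding strong_subgradient_def by (auto elim: in_subdifferentialE)
  have min: "ereal (a - f x) \<le> J u - ereal (f u)" for u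
    using a(2)[of u] by (cases "J u") (auto simp: blinfun.diff_right)
  have inf: "(INF u. J u - ereal (f u)) = ereal (a - f x)"
    using min a(1) by (intro antisym INF_lower2[of x] INF_greatest) auto
  show "attains_strong_minimum (\<lambda>x. J x - ereal (f x))"
    unfolding attains_strong_minimum_def inf
  proof (intro conjI exI[of _ x] allI impI)
    show "proper_fun (\<lambda>x. J x - ereal (f x))"
      unfolding proper_fun_def
    proof (intro conjI allI exI[of _ x])
      show "J u - ereal (f u) \<noteq> - \<infinity>" for u using min[of u] by auto
      show "J x - ereal (f x) < \<infinity>" using a(1) by simp
    qed
    show "J x - ereal (f x) \<le> J u - ereal (f u)" for u using min[of u] a(1) by simp
    fix X assume lim: "(\<lambda>n. J (X n) - ereal (f (X n))) \<longlonglongrightarrow> ereal (a - f x)"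
    show "X \<longlonglongrightarrow> x"
      unfolding tendsto_iff
    proof (intro allI impI)
      fix \<delta> :: real assume "0 < \<delta>"
      then obtain c where c: "0 < c" "\<And>u. \<delta> \<le> norm (u - x) \<Longrightarrow> J x + ereal (f (u - x) + c) \<le> J u"
        using x unfolding strong_subgradient_def by blast
      have "\<forall>\<^sub>F n in sequentially. J (X n) - ereal (f (X n)) < ereal (a - f x + c)"
        using lim c(1) by (intro order_tendstoD(2)) auto
      then show "\<forall>\<^sub>F n in sequentially. dist (X n) x < \<delta>"
      proof eventually_elim
        case (elim n)
        then have "\<not> J x + ereal (f (X n - x) + c) \<le> J (X n)"
          using a(1) by (cases "J (X n)") (auto simp: blinfun.diff_right)
        then show ?case using c(2)[of "X n"] by (auto simp: dist_norm not_le[symmetric])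
      qed
    qed
  qed
qed

text \<open>
  The function vanishing up to \<open>e\<close> and growing with slope \<open>k e\<close> afterwards is convex and continuous, so
  the supremum over all \<open>e\<close> is convex and lower semicontinuous. It is positive at \<open>t > 0\<close> thanks to
  \<open>e = t / 2\<close>.
\<close>
lemma Gamma0_SUP:
  fixes k :: "real \<Rightarrow> real"
  assumes k: "\<And>e. 0 < e \<Longrightarrow> 0 < k e"
  shows "(\<lambda>t. SUP e\<in>{0<..}. ereal (k e * max 0 (t - e))) \<in> Gamma0" (is "?\<psi> \<in> _")
proof -
  have le: "ereal (k e * max 0 (t - e)) \<le> ?\<psi> t" if "0 < e" for e t
    using that by (intro SUP_upper2[of e]) auto
  have nonneg: "0 \<le> ?\<psi> t" for t
    using le[of 1 t] k[of 1] by (intro order_trans[OF _ le[of 1 t]]) auto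
  have lsc: "lsc_on {0..} ?\<psi>"
    unfolding lsc_on_def le_Liminf_iff
  proof (intro ballI allI impI)
    fix t y assume "y < ?\<psi> t"
    then obtain e where e: "0 < e" "y < ereal (k e * max 0 (t - e))"
      by (auto simp: less_SUP_iff)
    have "((\<lambda>s. ereal (k e * max 0 (s - e))) \<longlongrightarrow> ereal (k e * max 0 (t - e))) (at t within {0..})"
      by (intro tendsto_intros)
    then have "\<forall>\<^sub>F s in at t within {0..}. y < ereal (k e * max 0 (s - e))"
      using e(2) by (rule order_tendstoD(1))
    then show "\<forall>\<^sub>F s in at t within {0..}. y < ?\<psi> s"
      by eventually_elim (rule less_le_trans[OF _ le[OF e(1)]])
  qed
  have cvx: "ereal_convex_on {0..} ?\<psi>"
    unfolding ereal_convex_on_def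
  proof (intro conjI ballI allI impI)
    fix s t u v :: real assume uv: "0 < u" "0 < v" "u + v = 1"
    show "?\<psi> (u *\<^sub>R s + v *\<^sub>R t) \<le> ereal u * ?\<psi> s + ereal v * ?\<psi> t"
    proof (rule SUP_least)
      fix e :: real assume "e \<in> {0<..}"
      then have e: "0 < e" by simp
      have "u * s + v * t - e = u * (s - e) + v * (t - e)"
        using uv(3) by (simp add: algebra_simps flip: distrib_left)
      also have "\<dots> \<le> u * max 0 (s - e) + v * max 0 (t - e)"
        using uv by (intro add_mono mult_left_mono) auto
      finally have "max 0 (u * s + v * t - e) \<le> u * max 0 (s - e) + v * max 0 (t - e)"
        using uv by simp
      then have "k e * max 0 (u * s + v * t - e) \<le> k e * (u * max 0 (s - e) + v * max 0 (t - e))"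
        using k[OF e] by (intro mult_left_mono) auto
      then have "ereal (k e * max 0 (u *\<^sub>R s + v *\<^sub>R t - e))
          \<le> ereal u * ereal (k e * max 0 (s - e)) + ereal v * ereal (k e * max 0 (t - e))"
        by (simp add: algebra_simps)
      also have "\<dots> \<le> ereal u * ?\<psi> s + ereal v * ?\<psi> t"
        using uv by (intro add_mono ereal_mult_left_mono le[OF e]) auto
      finally show "ereal (k e * max 0 (u *\<^sub>R s + v *\<^sub>R t - e)) \<le> ereal u * ?\<psi> s + ereal v * ?\<psi> t" .
    qed
  qed simp
  have zero: "?\<psi> t = 0 \<longleftrightarrow> t = 0" if "0 \<le> t" for t
  proof (cases "t = 0")
    case True
    have "?\<psi> 0 \<le> 0" by (intro SUP_least) (simp add: max_def)
    then show ?thesis using nonneg[of 0] True by (simp add: antisym)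
  next
    case False
    with that have "0 < k (t/2) * max 0 (t - t/2)" using k[of "t/2"] by simp
    then have "0 < ?\<psi> t" using le[of "t/2" t] that False by (intro less_le_trans[OF _ le[of "t/2" t]]) auto
    then show ?thesis using False by auto
  qed
  show ?thesis
    unfolding Gamma0_def using nonneg lsc cvx zero by blast
qed

text \<open>
  Convexity on the segment from \<open>0\<close>, where \<open>\<psi>\<close> vanishes, to \<open>t\<close>.
\<close>
lemma Gamma0_growth:
  assumes \<psi>: "\<psi> \<in> Gamma0" and \<delta>: "0 < \<delta>" "\<delta> \<le> t"
  shows "ereal (t / \<delta>) * \<psi> \<delta> \<le> \<psi> t" and "0 < \<psi> \<delta>"
proof -
  have z: "\<psi> 0 = 0" and pos: "\<And>s. 0 \<le> s \<Longrightarrow> 0 \<le> \<psi> s" and cvx: "ereal_convex_on {0..} \<psi>"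
    using \<psi> by (auto simp: Gamma0_def)
  show p: "0 < \<psi> \<delta>"
    using \<psi> \<delta> pos[of \<delta>] unfolding Gamma0_def by (auto simp: order_less_le)
  show "ereal (t / \<delta>) * \<psi> \<delta> \<le> \<psi> t"
  proof (cases "t = \<delta>")
    case True then show ?thesis using \<delta> by (simp flip: one_ereal_def)
  next
    case False
    define u where "u = \<delta> / t"
    have u: "0 < u" "0 < 1 - u" "u * t = \<delta>" using \<delta> False by (auto simp: u_def)
    have t: "0 \<le> t" using \<delta> by simp
    have "\<psi> (u *\<^sub>R t + (1 - u) *\<^sub>R 0) \<le> ereal u * \<psi> t + ereal (1 - u) * \<psi> 0"
      using cvx u t unfolding ereal_convex_on_def by (simp del: real_scaleR_def scaleR_zero_right)
    then have "\<psi> \<delta> \<le> ereal u * \<psi> t" using u z by simp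
    then have "ereal (t / \<delta>) * \<psi> \<delta> \<le> ereal (t / \<delta>) * (ereal u * \<psi> t)"
      using \<delta> by (intro ereal_mult_left_mono) auto
    also have "\<dots> = \<psi> t"
      using \<delta> by (simp add: u_def mult.assoc[symmetric] flip: one_ereal_def)
    finally show ?thesis .
  qed
qed

text \<open>
  Convexity upgrades the constant gap \<open>c\<close> on the sphere of radius \<open>e\<close> to linear growth outside it:
  compare \<open>u\<close> with the point \<open>w\<close> of that sphere on the segment from \<open>x\<close> to \<open>u\<close>.
\<close>
lemma strong_subgradient_linear_growth:
  assumes cvx: "convex (epi J)" and x: "strong_subgradient J x f" and e: "0 < e"
  obtains k where "0 < k"
    and "\<And>u. J x + ereal (f (u - x) + k * max 0 (norm (u - x) - e)) \<le> J u"
proof -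
  obtain a where a: "J x = ereal a" and sub: "\<And>u. ereal (a + f (u - x)) \<le> J u"
    using x unfolding strong_subgradient_def by (auto elim: in_subdifferentialE)
  obtain c where c: "0 < c" "\<And>u. e \<le> norm (u - x) \<Longrightarrow> J x + ereal (f (u - x) + c) \<le> J u"
    using x e unfolding strong_subgradient_def by blast
  show ?thesis
  proof
    show "0 < c / e" using c(1) e by simp
    show "J x + ereal (f (u - x) + c / e * max 0 (norm (u - x) - e)) \<le> J u" for u
    proof (cases "e \<le> norm (u - x)")
      case False then show ?thesis using sub[of u] a by simp
    next
      case True
      define t where "t = e / norm (u - x)"
      have n: "0 < norm (u - x)" using e True by linarith
      have t: "0 < t" "t \<le> 1" "t * norm (u - x) = e"
        using e True n by (auto simp: t_def)
      define w where "w = (1 - t) *\<^sub>R x + t *\<^sub>R u"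
      have wx: "w - x = t *\<^sub>R (u - x)" by (simp add: w_def algebra_simps)
      have Jw: "J x + ereal (f (w - x) + c) \<le> J w"
        using t by (intro c(2)) (simp add: wx)
      have "ereal (a + f (u - x) + c / e * max 0 (norm (u - x) - e)) \<le> J u"
      proof (rule ereal_leI_epi)
        fix s assume s: "J u \<le> ereal s"
        have "J w \<le> ereal ((1 - t) * a + t * s)"
          unfolding w_def using t a s by (intro epi_convex_comb[OF cvx]) auto
        from order_trans[OF Jw this]
        have "c \<le> t * (s - a - f (u - x))"
          using a by (simp add: wx blinfun.scaleR_right blinfun.diff_right algebra_simps)
        then have "c / t \<le> s - a - f (u - x)" using t(1) by (simp add: pos_divide_le_eq mult.commute)
        moreover have "c / e * max 0 (norm (u - x) - e) \<le> c / e * norm (u - x)"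
          using c(1) e by (intro mult_left_mono) auto
        moreover have "c / e * norm (u - x) = c / t" by (simp add: t_def)
        ultimately show "a + f (u - x) + c / e * max 0 (norm (u - x) - e) \<le> s" by linarith
      qed
      then show ?thesis using a by (simp add: add.assoc)
    qed
  qed
qed

text \<open>
  From left to right, the linear growth outside every ball supplies slopes whose hinge functions have
  the required supremum. From right to left, \<open>\<psi>\<close> is bounded below by \<open>\<psi> \<delta> > 0\<close> beyond \<open>\<delta>\<close>.
\<close>
lemma strong_subgradient_iff_Gamma0:
  assumes cvx: "convex (epi J)" and f: "f \<in> subdifferential J x"
  shows "strong_subgradient J x f \<longleftrightarrow>
    (\<exists>\<psi>\<in>Gamma0. \<forall>u. J u \<ge> J x + ereal (blinfun_apply f (u - x)) + \<psi> (norm (u - x)))"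
proof -
  obtain a where a: "J x = ereal a" and sub: "\<And>u. ereal (a + f (u - x)) \<le> J u"
    using f by (rule in_subdifferentialE) blast
  show ?thesis
  proof
    assume "strong_subgradient J x f"
    then have "\<exists>k>0. \<forall>u. J x + ereal (f (u - x) + k * max 0 (norm (u - x) - e)) \<le> J u" if "0 < e" for e
      using strong_subgradient_linear_growth[OF cvx] that by blast
    then obtain k where k: "\<And>e. 0 < e \<Longrightarrow> 0 < k e"
      "\<And>e u. 0 < e \<Longrightarrow> J x + ereal (f (u - x) + k e * max 0 (norm (u - x) - e)) \<le> J u"
      by metis
    define \<psi> where "\<psi> = (\<lambda>t. SUP e\<in>{0<..}. ereal (k e * max 0 (t - e)))"
    have "\<psi> \<in> Gamma0" unfolding \<psi>_def using k(1) by (rule Gamma0_SUP)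
    moreover have "J x + ereal (f (u - x)) + \<psi> (norm (u - x)) \<le> J u" for u
    proof (cases "J u")
      case (real s)
      then have "\<psi> (norm (u - x)) \<le> ereal (s - (a + f (u - x)))"
        unfolding \<psi>_def using k(2)[of _ u] a real by (intro SUP_least) (force simp: algebra_simps)
      then show ?thesis using a real by (cases "\<psi> (norm (u - x))") auto
    qed (use sub[of u] in auto)
    ultimately show "\<exists>\<psi>\<in>Gamma0. \<forall>u. J u \<ge> J x + ereal (f (u - x)) + \<psi> (norm (u - x))" by blast
  next
    assume "\<exists>\<psi>\<in>Gamma0. \<forall>u. J u \<ge> J x + ereal (f (u - x)) + \<psi> (norm (u - x))"
    then obtain \<psi> where \<psi>: "\<psi> \<in> Gamma0" "\<And>u. J x + ereal (f (u - x)) + \<psi> (norm (u - x)) \<le> J u"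
      by blast
    have "\<exists>c>0. \<forall>u. \<delta> \<le> norm (u - x) \<longrightarrow> J x + ereal (f (u - x) + c) \<le> J u" if \<delta>: "0 < \<delta>" for \<delta>
    proof -
      obtain c where c: "0 < ereal c" "ereal c < \<psi> \<delta>"
        using ereal_dense2[OF Gamma0_growth(2)[OF \<psi>(1) \<delta> order_refl]] by blast
      have "J x + ereal (f (u - x) + c) \<le> J u" if u: "\<delta> \<le> norm (u - x)" for u
      proof -
        have pos: "0 < \<psi> \<delta>" by (rule Gamma0_growth(2)[OF \<psi>(1) \<delta> order_refl])
        have "1 * \<psi> \<delta> \<le> ereal (norm (u - x) / \<delta>) * \<psi> \<delta>"
          using u \<delta> c by (intro ereal_mult_right_mono) (auto simp: one_ereal_def less_imp_le pos)
        also have "\<dots> \<le> \<psi> (norm (u - x))" by (rule Gamma0_growth(1)[OF \<psi>(1) \<delta> u])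
        finally have "ereal c \<le> \<psi> (norm (u - x))" using c(2) by simp
        then have "J x + ereal (f (u - x)) + ereal c \<le> J x + ereal (f (u - x)) + \<psi> (norm (u - x))"
          by (intro add_left_mono)
        also note \<psi>(2)
        finally show ?thesis by (simp add: add.assoc)
      qed
      then show ?thesis using c(1) by auto
    qed
    then show "strong_subgradient J x f" unfolding strong_subgradient_def using f by blast
  qed
qed

section \<open>Strong adequacy implies convexity\<close>

text \<open>
  At such \<open>f\<close> the conjugate has directional derivative at most \<open>g x\<close> in each direction \<open>g\<close>.
  Indeed, in the supremum defining
  \<open>J\<^sup>* (f + t g)\<close> the points \<open>u\<close> within \<open>\<delta>\<close> of \<open>x\<close> contribute at most \<open>J\<^sup>* f + t (g x + \<delta> * norm g)\<close>. The
  other points lose the gap \<open>c\<close> at \<open>t = 0\<close> and are bounded at \<open>t = s\<close> because \<open>J\<^sup>* (f + s g)\<close> is finite;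
  interpolating between these bounds shows that they do not matter for small \<open>t\<close>. So
  \<open>F g \<le> g x\<close> for every \<open>g\<close>, and \<open>- g\<close> gives the reverse inequality.
\<close>
lemma subdifferential_conjugate_at_strong_subgradient:
  assumes x: "strong_subgradient J x f" and F: "F \<in> subdifferential (conjugate J) f"
    and open_dom: "\<And>g. \<exists>s>0. conjugate J (f + s *\<^sub>R g) < \<infinity>"
  shows "F = bidual_embedding x"
proof -
  have f: "f \<in> subdifferential J x" using x by (simp add: strong_subgradient_def)
  then obtain a where a: "J x = ereal a" "\<And>u. ereal (a + f (u - x)) \<le> J u"
    by (rule in_subdifferentialE) blast
  have Jf: "conjugate J f = ereal (f x - a)"
    using subdifferential_conjugate(2)[OF f] a(1) by simp
  have F': "ereal (f x - a + F (g - f)) \<le> conjugate J g" for g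
    using F mem_subdifferential[of "conjugate J" f, OF Jf] by blast
  have le: "F g \<le> g x" for g
  proof -
    have "F g \<le> g x + \<delta> * norm g" if \<delta>: "0 < \<delta>" for \<delta>
    proof -
      obtain s where s: "0 < s" "conjugate J (f + s *\<^sub>R g) < \<infinity>" using open_dom by blast
      then obtain M where M: "conjugate J (f + s *\<^sub>R g) \<le> ereal M"
        by (cases "conjugate J (f + s *\<^sub>R g)") auto
      obtain c where c: "0 < c" "\<And>u. \<delta> \<le> norm (u - x) \<Longrightarrow> J x + ereal (f (u - x) + c) \<le> J u"
        using x \<delta> unfolding strong_subgradient_def by blast
      define K where "K = a + c - f x + M - s * (g x + \<delta> * norm g)"
      \<comment> \<open>The weight of the bound at \<open>s\<close>, small enough that the gap \<open>c\<close> outweighs the error \<open>l * K\<close>.\<close>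
      define l where "l = c / (c + \<bar>K\<bar>)"
      have l: "0 < l" "l \<le> 1" using c(1) by (auto simp: l_def)
      have "l * K \<le> l * \<bar>K\<bar>" using l by (intro mult_left_mono) auto
      also have "\<dots> \<le> c" using c(1) by (simp add: l_def field_simps)
      finally have lK: "l * K \<le> c" .
      define t where "t = l * s"
      have t: "0 < t" using l s by (simp add: t_def)
      define b where "b = f x - a + t * (g x + \<delta> * norm g)"
      have "ereal ((f + t *\<^sub>R g) u - b) \<le> J u" for u
      proof (cases "\<delta> \<le> norm (u - x)")
        case False
        have "g (u - x) \<le> norm g * norm (u - x)"
          using norm_blinfun[of g "u - x"] by simp
        also have "\<dots> \<le> norm g * \<delta>" using False by (intro mult_left_mono) auto
        finally have "g u \<le> g x + \<delta> * norm g"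
          by (simp add: blinfun.diff_right algebra_simps)
        then have "t * g u \<le> t * (g x + \<delta> * norm g)"
          using t by (intro mult_left_mono) auto
        then have "ereal ((f + t *\<^sub>R g) u - b) \<le> ereal (a + f (u - x))"
          by (simp add: b_def blinfun.diff_right blinfun.add_left blinfun.scaleR_left)
        then show ?thesis using a(2) order_trans by blast
      next
        case True
        show ?thesis
        proof (rule ereal_leI_epi)
          fix r assume r: "J u \<le> ereal r"
          have A: "a + f (u - x) + c \<le> r"
            using order_trans[OF c(2)[OF True] r] a(1) by (simp add: add.assoc)
          have "ereal ((f + s *\<^sub>R g) u - M) \<le> ereal r"
            using M r unfolding conjugate_le_iff by (meson order_trans)
          then have B: "f u + s * g u - M \<le> r"
            by (simp add: blinfun.add_left blinfun.scaleR_left)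
          have "(1 - l) * (a + f (u - x) + c) + l * (f u + s * g u - M) \<le> (1 - l) * r + l * r"
            using l A B by (intro add_mono mult_left_mono) auto
          then have "f u + t * g u + (a + c - f x) - l * (a + c - f x + M) \<le> r"
            by (simp add: t_def blinfun.diff_right algebra_simps)
          moreover have "l * K = l * (a + c - f x + M) - t * (g x + \<delta> * norm g)"
            by (simp add: K_def t_def algebra_simps)
          ultimately show "(f + t *\<^sub>R g) u - b \<le> r"
            using lK by (simp add: b_def blinfun.add_left blinfun.scaleR_left)
        qed
      qed
      then have "conjugate J (f + t *\<^sub>R g) \<le> ereal b" by (simp add: conjugate_le_iff)
      from order_trans[OF F' this] have "t * F g \<le> t * (g x + \<delta> * norm g)"
        by (simp add: b_def blinfun.scaleR_right)
      then show ?thesis using t by simp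
    qed
    note * = this
    show ?thesis
    proof (rule field_le_epsilon)
      fix e :: real assume "0 < e"
      then have "e / (norm g + 1) * norm g \<le> e"
        by (simp add: pos_divide_le_eq add_nonneg_pos distrib_left)
      moreover have "F g \<le> g x + e / (norm g + 1) * norm g"
        using \<open>0 < e\<close> by (intro *) (simp add: add_nonneg_pos)
      ultimately show "F g \<le> g x + e" by linarith
    qed
  qed
  show ?thesis
  proof (rule blinfun_eqI)
    fix g show "F g = bidual_embedding x g"
      using le[of g] le[of "- g"] by (simp add: blinfun.minus_right blinfun.minus_left)
  qed
qed

text \<open>
  The inequality \<open>J \<le> J\<^sup>*\<^sup>*\<close> without convexity of \<open>J\<close>. With \<open>m = inf (J\<^sup>* f - f x0)\<close> one has
  \<open>J\<^sup>*\<^sup>* x0 = - m \<le> b\<close>, and \<open>x0\<close>, seen in the bidual, is a \<open>\<delta>\<close>-subgradient of \<open>J\<^sup>*\<close> at any near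
  minimizer \<open>f0\<close>. The Bronsted-Rockafellar theorem in the dual perturbs it to an exact subgradient,
  which by hypothesis is a point \<open>x\<close> of the space where \<open>J\<close> has a subgradient. Such points are close to
  \<open>x0\<close>, with \<open>J x \<le> - m + 2 * \<delta>\<close>, and \<open>J\<close> is lower semicontinuous.
\<close>
lemma dense_subgradients_biconjugate:
  assumes reflects: "\<And>f F. F \<in> subdifferential (conjugate J) f \<Longrightarrow>
      \<exists>x::'a::banach. F = bidual_embedding x \<and> f \<in> subdifferential J x"
    and closed: "closed (epi J)" and fin: "conjugate J f1 < \<infinity>"
    and b: "\<And>f. ereal (blinfun_apply f x0 - b) \<le> conjugate J f"
  shows "J x0 \<le> ereal b"
proof -
  let ?E = "(\<lambda>(f, r). r - blinfun_apply f x0) ` epi (conjugate J)"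
  define m where "m = Inf ?E"
  have bE: "- b \<le> r - f x0" if "conjugate J f \<le> ereal r" for f r
    using order_trans[OF b that] by simp
  have bdd: "bdd_below ?E" by (rule bdd_belowI2[of _ "- b"]) (use bE in auto)
  obtain r1 where "conjugate J f1 \<le> ereal r1"
    using fin by (cases "conjugate J f1") auto
  then have "(f1, r1) \<in> epi (conjugate J)" by simp
  then have ne: "?E \<noteq> {}" by blast
  have mb: "- b \<le> m" unfolding m_def using ne bE by (intro cInf_greatest) auto
  have m_le: "ereal (m + bidual_embedding x0 f) \<le> conjugate J f" for f
  proof (rule ereal_leI_epi)
    fix r assume "conjugate J f \<le> ereal r"
    then have "r - f x0 \<in> ?E" by force
    from cInf_lower[OF this bdd] show "m + bidual_embedding x0 f \<le> r" by (simp add: m_def)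
  qed
  have approx: "\<exists>x a. norm (x - x0) \<le> \<delta> \<and> J x = ereal a \<and> a \<le> - m + 2 * \<delta>" if \<delta>: "0 < \<delta>" for \<delta>
  proof -
    have "m < m + \<delta>" using \<delta> by simp
    then obtain f0 r0 where f0: "conjugate J f0 \<le> ereal r0" "r0 - f0 x0 < m + \<delta>"
      unfolding m_def cInf_less_iff[OF ne bdd] by auto
    then have "ereal r0 \<le> ereal (m + bidual_embedding x0 f0 + \<delta>)" by simp
    with f0(1) have f0': "conjugate J f0 \<le> ereal (m + bidual_embedding x0 f0 + \<delta>)"
      by (rule order_trans)
    \<comment> \<open>The slope error \<open>e\<close> is multiplied by the norm of \<open>f\<close>, which is at most \<open>norm f0 + \<delta> / e\<close>.\<close>
    define e where "e = \<delta> / (1 + norm f0)"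
    have n0: "0 < 1 + norm f0" by (simp add: add_pos_nonneg)
    have e: "0 < e" "e + e * norm f0 = \<delta>"
      using \<delta> n0 by (simp_all add: e_def add_divide_distrib[symmetric] distrib_left[symmetric] field_simps)
    obtain f F where F: "F \<in> subdifferential (conjugate J) f" "norm (F - bidual_embedding x0) \<le> e"
      "e * norm (f - f0) \<le> \<delta>"
      by (rule Bronsted_Rockafellar[OF convex_closed_epi_conjugate m_le f0' e(1)])
    obtain x where x: "F = bidual_embedding x" "f \<in> subdifferential J x"
      using reflects[OF F(1)] by blast
    obtain a where a: "J x = ereal a"
      using x(2) by (rule in_subdifferentialE) blast
    have xe: "norm (x - x0) \<le> e"
      using norm_bidual_embedding_ge[of "x - x0"] F(2) by (simp add: bidual_embedding_diff x(1))
    have "m + f x0 \<le> f x - a"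
      using m_le[of f] subdifferential_conjugate(2)[OF x(2)] a by simp
    moreover have "f (x - x0) \<le> norm f * norm (x - x0)"
      using norm_blinfun[of f "x - x0"] by simp
    moreover have "norm f * norm (x - x0) \<le> (norm (f - f0) + norm f0) * e"
      using xe norm_triangle_ineq[of "f - f0" f0] by (intro mult_mono) auto
    ultimately have "a \<le> - m + 2 * \<delta>"
      using F(3) e by (simp add: blinfun.diff_right algebra_simps)
    moreover have "0 \<le> e * norm f0" using e(1) by simp
    then have "norm (x - x0) \<le> \<delta>" using xe e(2) by linarith
    ultimately show ?thesis using a by blast
  qed
  have "(x0, - m) \<in> epi J"
    unfolding closed_approachable[OF closed, symmetric]
  proof (intro allI impI)
    fix d :: real assume d: "0 < d"
    then obtain x a where x: "norm (x - x0) \<le> d / 4" "J x = ereal a" "a \<le> - m + 2 * (d / 4)"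
      using approx[of "d / 4"] by auto
    have "dist (x, - m + d / 2) (x0, - m) \<le> norm (x - x0) + d / 2"
      using d norm_Pair_le[of "x - x0" "d / 2"] by (simp add: dist_norm)
    also have "\<dots> < d" using x(1) d by simp
    finally show "\<exists>z\<in>epi J. dist z (x0, - m) < d"
      using x by (intro bexI[of _ "(x, - m + d / 2)"]) auto
  qed
  then have "J x0 \<le> ereal (- m)" by simp
  also have "\<dots> \<le> ereal b" using mb by simp
  finally show ?thesis .
qed

text \<open>
  Strong minima identify all subgradients of \<open>J\<^sup>*\<close> with points of the space, so \<open>J = J\<^sup>*\<^sup>*\<close>, and the
  biconjugate is convex as a supremum of affine functions. Openness of the domain makes \<open>J\<^sup>*\<close> finite at some point \<open>f + s g\<close> in each direction \<open>g\<close>.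
\<close>
lemma convex_epi_if_strongly_adequate:
  fixes J :: "'a::banach \<Rightarrow> ereal"
  assumes lsc: "lsc_on UNIV J" and sa: "strongly_adequate J"
  shows "convex (epi J)"
proof -
  let ?D = "dom_subdifferential (conjugate J)"
  have proper: "proper_fun J" and opn: "open ?D" and ne: "?D \<noteq> {}"
    and strong: "\<And>f. f \<in> ?D \<Longrightarrow> \<exists>x. strong_subgradient J x f"
    using sa strong_minimum_iff[of J] unfolding strongly_adequate_def by auto
  have fin: "conjugate J f < \<infinity>" if "f \<in> ?D" for f
    using that by (auto simp: dom_subdifferential_def elim: in_subdifferentialE)
  have reflects: "\<exists>x. F = bidual_embedding x \<and> f \<in> subdifferential J x"
    if F: "F \<in> subdifferential (conjugate J) f" for f F
  proof -
    have f: "f \<in> ?D" using F by (auto simp: dom_subdifferential_def)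
    then obtain x where x: "strong_subgradient J x f" using strong by blast
    have "\<exists>s>0. conjugate J (f + s *\<^sub>R g) < \<infinity>" for g
    proof -
      obtain d where d: "0 < d" "ball f d \<subseteq> ?D" using opn f openE by blast
      define s where "s = d / (1 + norm g)"
      have n: "0 < 1 + norm g" by (simp add: add_pos_nonneg)
      have s: "0 < s" "s * norm g < d" using d n by (simp_all add: s_def field_simps)
      then have "f + s *\<^sub>R g \<in> ball f d" by (simp add: dist_norm)
      then show ?thesis using d(2) fin s(1) by blast
    qed
    then have "F = bidual_embedding x"
      by (rule subdifferential_conjugate_at_strong_subgradient[OF x F])
    then show ?thesis using x by (auto simp: strong_subgradient_def)
  qed
  obtain f1 where f1: "f1 \<in> ?D" using ne by blast
  have "J x \<le> ereal b \<longleftrightarrow> (\<forall>f. ereal (blinfun_apply f x - b) \<le> conjugate J f)" for x b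
    using dense_subgradients_biconjugate[OF reflects closed_epi_lsc[OF lsc] fin[OF f1], of x b]
      Fenchel_Young[of J x b] by blast
  then have "epi J = (\<Inter>f. {(x, b). ereal (blinfun_apply f x - b) \<le> conjugate J f})"
    by auto
  then show ?thesis
    by (simp only:) (intro convex_INT ballI convex_closed_minorants)
qed

text \<open>
  The slope \<open>f\<close> lies in \<open>dom \<partial>J\<^sup>*\<close>, so \<open>J - f\<close> has a strong minimum, and \<open>x\<close> is a minimum point of
  \<open>J - f\<close>.
\<close>
lemma strong_subgradient_if_strongly_adequate:
  assumes sa: "strongly_adequate J" and f: "f \<in> subdifferential J x"
  shows "strong_subgradient J x f"
proof -
  have "f \<in> dom_subdifferential (conjugate J)"
    using subdifferential_conjugate(1)[OF f] by (auto simp: dom_subdifferential_def)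
  then obtain y where "strong_subgradient J y f"
    using sa strong_minimum_iff[of J f] unfolding strongly_adequate_def by blast
  then show ?thesis using strong_subgradient_unique[OF _ f] by blast
qed

section \<open>Strong adequacy and essential firm subdifferentiability\<close>

text \<open>
  Linear growth of \<open>J - f\<close> with slope \<open>c\<close> absorbs perturbations \<open>g - f\<close> of norm at most \<open>c\<close>, so
  \<open>J\<^sup>*\<close> is bounded above on a ball around \<open>f\<close>, and a convex function is subdifferentiable where it is
  locally bounded above. The
  subgradients live in the bidual, where they exist whether or not \<open>J - g\<close> has a minimum.
\<close>
lemma conjugate_subdifferentiable_near_strong_subgradient:
  fixes J :: "'a::real_normed_vector \<Rightarrow> ereal"
  assumes cvx: "convex (epi J)" and x: "strong_subgradient J x f"
  shows "\<exists>d>0. ball f d \<subseteq> dom_subdifferential (conjugate J)"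
proof -
  obtain a where a: "J x = ereal a" "\<And>u. ereal (a + f (u - x)) \<le> J u"
    using x unfolding strong_subgradient_def by (auto elim: in_subdifferentialE)
  obtain c where c: "0 < c" "\<And>u. J x + ereal (f (u - x) + c * max 0 (norm (u - x) - 1)) \<le> J u"
    using strong_subgradient_linear_growth[OF cvx x zero_less_one] by blast
  have grow: "ereal (a + f (u - x) + c * norm (u - x) - c) \<le> J u" for u
  proof -
    have "c * (norm (u - x) - 1) \<le> c * max 0 (norm (u - x) - 1)"
      using c(1) by (intro mult_left_mono) auto
    then have "ereal (a + f (u - x) + c * norm (u - x) - c)
        \<le> J x + ereal (f (u - x) + c * max 0 (norm (u - x) - 1))"
      using a(1) by (simp add: algebra_simps)
    also note c(2)
    finally show ?thesis .
  qed
  have up: "conjugate J g \<le> ereal ((norm f + c) * norm x - a + c)" if g: "norm (g - f) \<le> c" for g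
  proof -
    have "ereal (g u - ((norm f + c) * norm x - a + c)) \<le> J u" for u
    proof -
      have "(g - f) (u - x) \<le> c * norm (u - x)"
        using norm_blinfun[of "g - f" "u - x"] mult_right_mono[OF g, of "norm (u - x)"] by simp
      moreover have "g x \<le> (norm f + c) * norm x"
        using norm_blinfun[of g x] mult_right_mono[of "norm g" "norm f + c" "norm x"]
          norm_triangle_ineq2[of g f] g by simp
      ultimately have "g u - ((norm f + c) * norm x - a + c) \<le> a + f (u - x) + c * norm (u - x) - c"
        by (simp add: blinfun.diff_left blinfun.diff_right)
      then show ?thesis using grow[of u] by (meson ereal_less_eq(3) order_trans)
    qed
    then show ?thesis by (simp add: conjugate_le_iff)
  qed
  have "g \<in> dom_subdifferential (conjugate J)" if g: "g \<in> ball f (c / 2)" for g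
  proof -
    have gf: "norm (g - f) \<le> c / 2" using g by (simp add: dist_norm norm_minus_commute)
    have fin: "\<bar>conjugate J g\<bar> \<noteq> \<infinity>"
      using up[of g] gf c(1) Fenchel_Young[of J x a g] a(1) by (cases "conjugate J g") auto
    then obtain r where r: "conjugate J g = ereal r" by auto
    have "conjugate J w \<le> ereal ((norm f + c) * norm x - a + c)" if "norm (w - g) \<le> c / 2" for w
      using that gf norm_triangle_ineq[of "w - g" "g - f"] by (intro up) simp
    then show ?thesis
      using subdifferentiable_if_bounded_above[OF convex_closed_epi_conjugate(1) _ r, of "c / 2"] c(1)
      by (auto simp: dom_subdifferential_def)
  qed
  then show ?thesis using c(1) by (intro exI[of _ "c / 2"]) auto
qed

theorem theorem1:
  fixes J :: "'a::banach \<Rightarrow> ereal"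
  assumes "proper_fun J" and "lsc_on UNIV J"
  shows "(strongly_adequate J \<longrightarrow> essentially_firmly_subdifferentiable J) \<and>
    (reflexive_space TYPE('a) \<and> essentially_firmly_subdifferentiable J \<longrightarrow> strongly_adequate J)"
proof (intro conjI impI; (elim conjE)?)
  have fin: "J x \<noteq> - \<infinity>" for x using assms(1) by (simp add: proper_fun_def)
  assume sa: "strongly_adequate J"
  have cvx: "convex (epi J)" by (rule convex_epi_if_strongly_adequate[OF assms(2) sa])
  have "firmly_subdifferentiable_at J x" if "x \<in> dom_subdifferential J" for x
    unfolding firmly_subdifferentiable_at_def
    using that strong_subgradient_if_strongly_adequate[OF sa] strong_subgradient_iff_Gamma0[OF cvx]
    by blast
  then show "essentially_firmly_subdifferentiable J"
    unfolding essentially_firmly_subdifferentiable_def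
    using assms(1) cvx ereal_convex_on_iff_epi[of J] fin by blast
next
  have fin: "J x \<noteq> - \<infinity>" for x using assms(1) by (simp add: proper_fun_def)
  assume refl: "reflexive_space TYPE('a)" and firm: "essentially_firmly_subdifferentiable J"
  have cvx: "convex (epi J)"
    using firm ereal_convex_on_iff_epi[of J] fin unfolding essentially_firmly_subdifferentiable_def by blast
  note closed = closed_epi_lsc[OF assms(2)]
  let ?D = "dom_subdifferential (conjugate J)"
  have strong: "\<exists>x. strong_subgradient J x f" if f: "f \<in> ?D" for f
  proof -
    obtain F where F: "F \<in> subdifferential (conjugate J) f"
      using f by (auto simp: dom_subdifferential_def)
    obtain x :: 'a where "\<forall>g. blinfun_apply F g = blinfun_apply g x"
      using refl unfolding reflexive_space_def by blast
    then have "F = bidual_embedding x" by (intro blinfun_eqI) simp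
    then have sub: "f \<in> subdifferential J x"
      using bidual_subgradient_reflects[OF cvx closed assms(1)] F by blast
    then have "x \<in> dom_subdifferential J" by (auto simp: dom_subdifferential_def)
    then have "firmly_subdifferentiable_at J x"
      using firm by (simp add: essentially_firmly_subdifferentiable_def)
    then show ?thesis
      using sub strong_subgradient_iff_Gamma0[OF cvx sub] unfolding firmly_subdifferentiable_at_def by blast
  qed
  have "open ?D"
    unfolding open_contains_ball
    using strong conjugate_subdifferentiable_near_strong_subgradient[OF cvx] by blast
  then show "strongly_adequate J"
    unfolding strongly_adequate_def
    using assms(1) dom_subdifferential_conjugate_nonempty[OF cvx closed assms(1)] strong
      strong_minimum_iff[OF assms(1)] by blast
qed

end
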